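(* Let $K$ be a field and let $L_{13}$ be the three-dimensional Leibniz algebra over $K$ with basis $\{e_1,e_2,e_3\}$ and nonzero products of basis elements $e_3e_3=e_1$, $e_1e_3=e_1+e_2$. Let $\mathcal B_{L_{13}}\subset\mathcal L\langle X\rangle$ be the set consisting of all monomials of the form \[ x_{j_1}^{(m_1)}x_{j_2}^{(m_2)}\cdots x_{j_n}^{(m_n)}\qquad\text{with } n\ge1,\ m_i\ge1,\ j_2<j_3<\dots<j_n\ \text{ and }\ j_1\ne j_k\text{ for all }k\ge2. \] If $K$ is infinite, then the images of $\mathcal B_{L_{13}}$ in the relatively free algebra $\mathcal L\langle X\rangle/T(L_{13})$ form a basis of this algebra. If $K$ is finite with $|K|=q$, then the images of the monomials of $\mathcal B_{L_{13}}$ subject to the following additional restrictions form a basis of $\mathcal L\langle X\rangle/T(L_{13})$: - if $m_1>1$, then $m_2<q$; - if $n=1$, then $1\le m_1\le q+1$; - if $n=2$, then $1\le m_i\le q$ for $i=1,2$, and in the case $m_1=m_2=1$ one further requires $j_1<j_2$; - if $n\ge3$, then $1\le m_1\le q$ and $1\le m_i<q$ for all $i\ge2$. Moreover, the codimension sequence of $L_{13}$ is given by $c_n(L_{13})=n$ for all $n\ge 1$, and the exponent of $L_{13}$ is equal to $1$.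
   Context: A (right) Leibniz algebra over $K$ is a $K$-algebra satisfying $x(yz)=(xy)z-(xz)y$. $\mathcal L\langle X\rangle$ is the free Leibniz algebra over $K$ on $X=\{x_1,x_2,\dots\}$; $T(L)$ is the ideal of polynomials vanishing under all substitutions of elements of $L$. Products without brackets are left-normed, and $x^{(m)}$ means $m$ consecutive occurrences of $x$ in a left-normed product; thus $x_{j_1}^{(m_1)}x_{j_2}^{(m_2)}\cdots$ is the left-normed product of $m_1$ copies of $x_{j_1}$, then $m_2$ copies of $x_{j_2}$, etc. (conditions on $m_2$ are void when $n=1$). $P_n\subset\mathcal L\langle X\rangle$ is the space of multilinear polynomials in $x_1,\dots,x_n$, $c_n(L)=\dim_K P_n/(P_n\cap T(L))$, and the exponent of $L$ is $\exp(L)=\lim_{n\to\infty}\sqrt[n]{c_n(L)}$. Products of basis elements not listed are zero. *)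

theory Defs
  imports
    "HOL-Analysis.Analysis"
    "HOL-Library.Poly_Mapping"
    "HOL-Library.Set_Algebras"
begin

section \<open>Leibniz algebras\<close>

locale leibniz_algebra = vector_space scale
  for scale :: "'k::field \<Rightarrow> 'a::ab_group_add \<Rightarrow> 'a" +
  fixes mul :: "'a \<Rightarrow> 'a \<Rightarrow> 'a"
  assumes mult_add_left: "mul (x + y) z = mul x z + mul y z"
    and mult_add_right: "mul x (y + z) = mul x y + mul x z"
    and mult_scale_left: "mul (scale c x) y = scale c (mul x y)"
    and mult_scale_right: "mul x (scale c y) = scale c (mul x y)"
    and leibniz: "mul x (mul y z) = mul (mul x y) z - mul (mul x z) y"

definition algebra_hom ::
  "('k::field \<Rightarrow> 'a::ab_group_add \<Rightarrow> 'a) \<Rightarrow> ('a \<Rightarrow> 'a \<Rightarrow> 'a) \<Rightarrow>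
   ('k \<Rightarrow> 'b::ab_group_add \<Rightarrow> 'b) \<Rightarrow> ('b \<Rightarrow> 'b \<Rightarrow> 'b) \<Rightarrow> ('a \<Rightarrow> 'b) \<Rightarrow> bool"
  where "algebra_hom scaleA mulA scaleB mulB f \<longleftrightarrow>
    Vector_Spaces.linear scaleA scaleB f \<and> (\<forall>x y. f (mulA x y) = mulB (f x) (f y))"

definition left_normed :: "('a \<Rightarrow> 'a \<Rightarrow> 'a) \<Rightarrow> 'a list \<Rightarrow> 'a"
  where "left_normed mul xs = foldl mul (hd xs) (tl xs)"

section \<open>The free Leibniz algebra\<close>

text \<open>
  The free Leibniz algebra on a countable set of variables is the free nonassociative algebra
  modulo the ideal generated by all values of the Leibniz identity. The variables are indexed
  by all natural numbers, index \<open>i\<close> standing for the variable \<open>x\<close> with subscript \<open>i + 1\<close>.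
\<close>

datatype nmon = Gen nat | Prod nmon nmon

fun letters :: "nmon \<Rightarrow> nat list" where
  "letters (Gen i) = [i]"
| "letters (Prod s t) = letters s @ letters t"

type_synonym 'k nonassoc = "nmon \<Rightarrow>\<^sub>0 'k"

lift_definition na_scale :: "'k::field \<Rightarrow> 'k nonassoc \<Rightarrow> 'k nonassoc"
  is "\<lambda>c p t. c * p t"
  by (erule rev_finite_subset) auto

text \<open>A nonassociative monomial factors in a unique way, so no convolution sum is needed.\<close>

lift_definition na_mult :: "'k::field nonassoc \<Rightarrow> 'k nonassoc \<Rightarrow> 'k nonassoc"
  is "\<lambda>p q t. case t of Gen i \<Rightarrow> 0 | Prod u v \<Rightarrow> p u * q v"
proof -
  fix p q :: "nmon \<Rightarrow> 'k"
  assume "finite {x. p x \<noteq> 0}" "finite {x. q x \<noteq> 0}"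
  then have "finite ((\<lambda>(u, v). Prod u v) ` ({x. p x \<noteq> 0} \<times> {x. q x \<noteq> 0}))"
    by simp
  moreover have "t \<in> (\<lambda>(u, v). Prod u v) ` ({x. p x \<noteq> 0} \<times> {x. q x \<noteq> 0})"
    if "(case t of Gen i \<Rightarrow> 0 | Prod u v \<Rightarrow> p u * q v) \<noteq> 0" for t
    using that by (cases t) auto
  ultimately show "finite {t. (case t of Gen i \<Rightarrow> 0 | Prod u v \<Rightarrow> p u * q v) \<noteq> 0}"
    by (auto elim: rev_finite_subset)
qed

inductive_set leibniz_ideal :: "'k::field nonassoc set" where
  gen: "na_mult x (na_mult y z) - na_mult (na_mult x y) z + na_mult (na_mult x z) y
      \<in> leibniz_ideal"
| add: "p \<in> leibniz_ideal \<Longrightarrow> q \<in> leibniz_ideal \<Longrightarrow> p + q \<in> leibniz_ideal"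
| scale: "p \<in> leibniz_ideal \<Longrightarrow> na_scale c p \<in> leibniz_ideal"
| mult_left: "p \<in> leibniz_ideal \<Longrightarrow> na_mult x p \<in> leibniz_ideal"
| mult_right: "p \<in> leibniz_ideal \<Longrightarrow> na_mult p x \<in> leibniz_ideal"

lemma na_scale_add_right: "na_scale c (p + q) = na_scale c p + na_scale c q"
  by transfer (auto simp: algebra_simps)

lemma na_scale_add_left: "na_scale (c + d) p = na_scale c p + na_scale d p"
  by transfer (auto simp: algebra_simps)

lemma na_scale_scale: "na_scale c (na_scale d p) = na_scale (c * d) p"
  by transfer (auto simp: algebra_simps)

lemma na_scale_one: "na_scale 1 p = p"
  by transfer auto

lemma na_scale_zero: "na_scale 0 p = 0"
  by transfer auto

lemma na_scale_minus_one: "na_scale (- 1) p = - p"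
  by transfer auto

lemma na_mult_add_left: "na_mult (p + q) r = na_mult p r + na_mult q r"
  by transfer (auto simp: algebra_simps fun_eq_iff split: nmon.splits)

lemma na_mult_add_right: "na_mult p (q + r) = na_mult p q + na_mult p r"
  by transfer (auto simp: algebra_simps fun_eq_iff split: nmon.splits)

lemma na_mult_scale_left: "na_mult (na_scale c p) q = na_scale c (na_mult p q)"
  by transfer (auto simp: algebra_simps fun_eq_iff split: nmon.splits)

lemma na_mult_scale_right: "na_mult p (na_scale c q) = na_scale c (na_mult p q)"
  by transfer (auto simp: algebra_simps fun_eq_iff split: nmon.splits)

lemma na_mult_diff_left: "na_mult (p - q) r = na_mult p r - na_mult q r"
  by (metis add_diff_cancel_right' diff_add_cancel na_mult_add_left)

lemma na_mult_diff_right: "na_mult p (q - r) = na_mult p q - na_mult p r"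
  by (metis add_diff_cancel_right' diff_add_cancel na_mult_add_right)

lemma na_scale_diff: "na_scale c (p - q) = na_scale c p - na_scale c q"
  by (metis add_diff_cancel_right' diff_add_cancel na_scale_add_right)

lemma leibniz_ideal_zero: "0 \<in> leibniz_ideal"
  using leibniz_ideal.scale[OF leibniz_ideal.gen, of 0] by (simp add: na_scale_zero)

lemma leibniz_ideal_uminus: "p \<in> leibniz_ideal \<Longrightarrow> - p \<in> leibniz_ideal"
  using leibniz_ideal.scale[of p "- 1"] by (simp add: na_scale_minus_one)

quotient_type (overloaded) 'k free_leibniz =
  "'k::field nonassoc" / "\<lambda>p q. p - q \<in> leibniz_ideal"
proof (rule equivpI)
  show "reflp (\<lambda>p q :: 'k nonassoc. p - q \<in> leibniz_ideal)"
    by (simp add: reflp_def leibniz_ideal_zero)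
  show "symp (\<lambda>p q :: 'k nonassoc. p - q \<in> leibniz_ideal)"
    by (metis (mono_tags, lifting) leibniz_ideal_uminus minus_diff_eq sympI)
  show "transp (\<lambda>p q :: 'k nonassoc. p - q \<in> leibniz_ideal)"
    by (rule transpI) (metis leibniz_ideal.add diff_add_cancel add_diff_eq)
qed

instantiation free_leibniz :: (field) ab_group_add
begin

lift_definition zero_free_leibniz :: "'a free_leibniz" is 0 .

lift_definition plus_free_leibniz :: "'a free_leibniz \<Rightarrow> 'a free_leibniz \<Rightarrow> 'a free_leibniz"
  is "(+)"
  by (metis leibniz_ideal.add add_diff_add)

lift_definition uminus_free_leibniz :: "'a free_leibniz \<Rightarrow> 'a free_leibniz" is uminus
  by (metis leibniz_ideal_uminus minus_diff_minus)

lift_definition minus_free_leibniz :: "'a free_leibniz \<Rightarrow> 'a free_leibniz \<Rightarrow> 'a free_leibniz"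
  is "(-)"
proof -
  fix p p' q q' :: "'a nonassoc"
  assume "p - p' \<in> leibniz_ideal" "q - q' \<in> leibniz_ideal"
  then have "(p - p') + - (q - q') \<in> leibniz_ideal"
    by (intro leibniz_ideal.add leibniz_ideal_uminus)
  then show "p - q - (p' - q') \<in> leibniz_ideal"
    by (simp add: algebra_simps)
qed

instance
  by standard (transfer; simp add: algebra_simps leibniz_ideal_zero)+

end

lift_definition fl_scale :: "'k::field \<Rightarrow> 'k free_leibniz \<Rightarrow> 'k free_leibniz" is na_scale
  by (metis leibniz_ideal.scale na_scale_diff)

lift_definition fl_mult :: "'k::field free_leibniz \<Rightarrow> 'k free_leibniz \<Rightarrow> 'k free_leibniz"
  is na_mult
proof -
  fix p p' q q' :: "'k nonassoc"
  assume "p - p' \<in> leibniz_ideal" "q - q' \<in> leibniz_ideal"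
  then have "na_mult (p - p') q + na_mult p' (q - q') \<in> leibniz_ideal"
    by (intro leibniz_ideal.intros)
  then show "na_mult p q - na_mult p' q' \<in> leibniz_ideal"
    by (simp add: na_mult_diff_left na_mult_diff_right)
qed

lift_definition fl_monomial :: "nmon \<Rightarrow> 'k::field free_leibniz"
  is "\<lambda>t. Poly_Mapping.single t 1" .

definition fl_var :: "nat \<Rightarrow> 'k::field free_leibniz"
  where "fl_var i = fl_monomial (Gen i)"

lemma free_leibniz_algebra:
  "leibniz_algebra (fl_scale :: 'k::field \<Rightarrow> _) fl_mult"
proof
  fix x y z :: "'k free_leibniz"
  show "fl_mult x (fl_mult y z) = fl_mult (fl_mult x y) z - fl_mult (fl_mult x z) y"
  proof transfer
    fix x y z :: "'k nonassoc"
    show "na_mult x (na_mult y z) - (na_mult (na_mult x y) z - na_mult (na_mult x z) y)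
      \<in> leibniz_ideal"
      using leibniz_ideal.gen[of x y z] by (simp add: algebra_simps)
  qed
qed (transfer; simp add: na_scale_add_left na_scale_add_right na_scale_scale na_scale_one
      na_mult_add_left na_mult_add_right na_mult_scale_left na_mult_scale_right
      leibniz_ideal_zero)+

fun nmon_value :: "('a \<Rightarrow> 'a \<Rightarrow> 'a) \<Rightarrow> (nat \<Rightarrow> 'a) \<Rightarrow> nmon \<Rightarrow> 'a" where
  "nmon_value mul \<rho> (Gen i) = \<rho> i"
| "nmon_value mul \<rho> (Prod s t) = mul (nmon_value mul \<rho> s) (nmon_value mul \<rho> t)"

lemma nonassoc_induct [case_names single sum]:
  assumes single: "\<And>t c. P (Poly_Mapping.single t c)"
    and sum: "\<And>p q. P p \<Longrightarrow> P q \<Longrightarrow> P (p + q)"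
  shows "P (p :: 'k::field nonassoc)"
proof (induction p rule: Poly_Mapping.update_induct)
  case const
  then show ?case using single[of undefined 0] by simp
next
  case (update p t c)
  have "Poly_Mapping.update t c p = p + Poly_Mapping.single t c"
    using update(1)
    by (intro poly_mapping_eqI) (auto simp: lookup_update lookup_add lookup_single in_keys_iff when_def)
  then show ?case using single sum update by simp
qed

lemma na_single_decomp:
  "Poly_Mapping.single t (c :: 'k::field) = na_scale c (Poly_Mapping.single t 1)"
  by transfer (auto simp: when_def)

lemma na_mult_single:
  "na_mult (Poly_Mapping.single s (c :: 'k::field)) (Poly_Mapping.single t d) =
    Poly_Mapping.single (Prod s t) (c * d)"
  by transfer (auto simp: when_def fun_eq_iff split: nmon.splits)

context leibniz_algebra
begin

definition na_value :: "(nat \<Rightarrow> 'a) \<Rightarrow> 'k nonassoc \<Rightarrow> 'a"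
  where "na_value \<rho> p = (\<Sum>t\<in>Poly_Mapping.keys p. scale (Poly_Mapping.lookup p t) (nmon_value mul \<rho> t))"

lemma na_value_superset:
  assumes "finite A" "Poly_Mapping.keys p \<subseteq> A"
  shows "na_value \<rho> p = (\<Sum>t\<in>A. scale (Poly_Mapping.lookup p t) (nmon_value mul \<rho> t))"
  unfolding na_value_def using assms
  by (intro sum.mono_neutral_left) (auto simp: in_keys_iff)

lemma na_value_add: "na_value \<rho> (p + q) = na_value \<rho> p + na_value \<rho> q"
proof -
  have "Poly_Mapping.keys (p + q) \<subseteq> Poly_Mapping.keys p \<union> Poly_Mapping.keys q"
    by (rule Poly_Mapping.keys_add)
  then show ?thesis
    by (subst (1 2 3) na_value_superset[of "Poly_Mapping.keys p \<union> Poly_Mapping.keys q"])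
      (auto simp: lookup_add scale_left_distrib sum.distrib)
qed

lemma na_value_scale: "na_value \<rho> (na_scale c p) = scale c (na_value \<rho> p)"
proof -
  have look: "Poly_Mapping.lookup (na_scale c p) t = c * Poly_Mapping.lookup p t" for t
    by transfer simp
  then have "Poly_Mapping.keys (na_scale c p) \<subseteq> Poly_Mapping.keys p"
    by (auto simp: in_keys_iff)
  then show ?thesis
    by (subst (1 2) na_value_superset[of "Poly_Mapping.keys p"]) (auto simp: look scale_sum_right)
qed

lemma na_value_minus: "na_value \<rho> (p - q) = na_value \<rho> p - na_value \<rho> q"
  by (metis add_diff_cancel_right' diff_add_cancel na_value_add)

lemma na_value_single:
  "na_value \<rho> (Poly_Mapping.single t c) = scale c (nmon_value mul \<rho> t)"
  by (subst na_value_superset[of "{t}"]) auto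

lemma mult_diff_left: "mul (x - y) z = mul x z - mul y z"
  by (metis add_diff_cancel_right' diff_add_cancel mult_add_left)

lemma mult_diff_right: "mul x (y - z) = mul x y - mul x z"
  by (metis add_diff_cancel_right' diff_add_cancel mult_add_right)

lemma mult_zero_left: "mul 0 x = 0"
  using mult_diff_left[of 0 0 x] by simp

lemma mult_zero_right: "mul x 0 = 0"
  using mult_diff_right[of x 0 0] by simp

lemma na_value_zero: "na_value \<rho> 0 = 0"
  by (simp add: na_value_def)

lemma na_mult_zero: "na_mult 0 p = 0" "na_mult p 0 = 0"
  using na_mult_diff_left[of 0 0 p] na_mult_diff_right[of p 0 0] by auto

lemma na_value_mult: "na_value \<rho> (na_mult p q) = mul (na_value \<rho> p) (na_value \<rho> q)"
proof -
  have *: "na_value \<rho> (na_mult (Poly_Mapping.single t c) q) =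
    mul (na_value \<rho> (Poly_Mapping.single t c)) (na_value \<rho> q)" for t c
    by (induction q rule: nonassoc_induct)
      (auto simp: na_mult_single na_value_single na_mult_add_right na_value_add mult_add_right
        mult_scale_left mult_scale_right)
  show ?thesis
    by (induction p rule: nonassoc_induct)
      (auto simp: * na_mult_add_left na_value_add mult_add_left)
qed

lemma na_value_leibniz_ideal: "p \<in> leibniz_ideal \<Longrightarrow> na_value \<rho> p = 0"
  by (induction p rule: leibniz_ideal.induct)
    (auto simp: na_value_add na_value_minus na_value_mult na_value_scale leibniz
      mult_zero_left mult_zero_right)

text \<open>
  The universal property: substituting elements of a Leibniz algebra for the variables is the
  same thing as applying a homomorphism from the free Leibniz algebra.
\<close>

theorem free_leibniz_universal:
  "\<exists>!\<phi>. algebra_hom fl_scale fl_mult scale mul \<phi> \<and> (\<forall>i. \<phi> (fl_var i) = \<rho> i)"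
proof (rule ex_ex1I)
  interpret fl: leibniz_algebra "fl_scale :: 'k \<Rightarrow> _" fl_mult
    by (rule free_leibniz_algebra)
  define \<phi> where "\<phi> f = na_value \<rho> (rep_free_leibniz f)" for f
  have abs: "\<phi> (abs_free_leibniz p) = na_value \<rho> p" for p
  proof -
    have "rep_free_leibniz (abs_free_leibniz p) - p \<in> leibniz_ideal"
      by (rule Quotient3_rep_abs[OF Quotient3_free_leibniz]) (simp add: leibniz_ideal_zero)
    then have "na_value \<rho> (rep_free_leibniz (abs_free_leibniz p) - p) = 0"
      by (rule na_value_leibniz_ideal)
    then show ?thesis
      by (simp add: \<phi>_def na_value_minus)
  qed
  have "\<phi> (f + g) = \<phi> f + \<phi> g" for f g
    by (induction f rule: free_leibniz.abs_induct; induction g rule: free_leibniz.abs_induct)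
      (simp add: plus_free_leibniz.abs_eq abs na_value_add)
  moreover have "\<phi> (fl_scale c f) = scale c (\<phi> f)" for c f
    by (induction f rule: free_leibniz.abs_induct) (simp add: fl_scale.abs_eq abs na_value_scale)
  moreover have "\<phi> (fl_mult f g) = mul (\<phi> f) (\<phi> g)" for f g
    by (induction f rule: free_leibniz.abs_induct; induction g rule: free_leibniz.abs_induct)
      (simp add: fl_mult.abs_eq abs na_value_mult)
  moreover have "\<phi> (fl_var i) = \<rho> i" for i
    by (simp add: fl_var_def fl_monomial.abs_eq abs na_value_single)
  ultimately show "\<exists>\<phi>. algebra_hom fl_scale fl_mult scale mul \<phi> \<and> (\<forall>i. \<phi> (fl_var i) = \<rho> i)"
    unfolding algebra_hom_def
    by (intro exI[of _ \<phi>])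
      (simp add: Vector_Spaces.linear_iff fl.vector_space_axioms vector_space_axioms)
next
  fix \<phi> \<psi>
  assume \<phi>: "algebra_hom fl_scale fl_mult scale mul \<phi> \<and> (\<forall>i. \<phi> (fl_var i) = \<rho> i)"
    and \<psi>: "algebra_hom fl_scale fl_mult scale mul \<psi> \<and> (\<forall>i. \<psi> (fl_var i) = \<rho> i)"
  have lin: "\<theta> (f + g) = \<theta> f + \<theta> g" "\<theta> (fl_scale c f) = scale c (\<theta> f)"
    "\<theta> (fl_mult f g) = mul (\<theta> f) (\<theta> g)"
    if "algebra_hom fl_scale fl_mult scale mul \<theta>" for \<theta> c f g
    using that unfolding algebra_hom_def Vector_Spaces.linear_iff by auto
  have mon: "\<phi> (fl_monomial t) = \<psi> (fl_monomial t)" for t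
  proof (induction t)
    case (Gen i)
    then show ?case using \<phi> \<psi> by (simp flip: fl_var_def)
  next
    case (Prod s t)
    have "fl_monomial (Prod s t) = fl_mult (fl_monomial s) (fl_monomial t :: 'k free_leibniz)"
      by (simp add: fl_monomial.abs_eq fl_mult.abs_eq na_mult_single)
    then show ?case using Prod \<phi> \<psi> by (simp add: lin)
  qed
  have "\<phi> (abs_free_leibniz p) = \<psi> (abs_free_leibniz p)" for p
  proof (induction p rule: nonassoc_induct)
    case (single t c)
    have "abs_free_leibniz (Poly_Mapping.single t c) = fl_scale c (fl_monomial t)"
      by (subst na_single_decomp) (simp add: fl_monomial.abs_eq fl_scale.abs_eq)
    then show ?case using \<phi> \<psi> by (simp add: lin mon)
  next
    case (sum p q)
    then show ?case using \<phi> \<psi> by (simp add: lin flip: plus_free_leibniz.abs_eq)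
  qed
  then have "\<phi> f = \<psi> f" for f
    by (induction f rule: free_leibniz.abs_induct)
  then show "\<phi> = \<psi>" ..
qed

end

section \<open>Quotient spaces\<close>

text \<open>
  For subspaces \<open>U\<close> of \<open>V\<close> in a vector space with scalar multiplication \<open>scl\<close>, the quotient
  space consists of the cosets \<open>v +o U\<close>. A linear combination of cosets is formed with
  elementwise operations on sets; the summand \<open>U\<close> accounts for the empty combination and for
  zero coefficients, since the elementwise multiple of a coset by zero is only \<open>{0}\<close>.
  Independence, span, basis and dimension then follow the pattern of the library's definitions
  for a vector space that is a whole type.
\<close>

definition quotient_space :: "'a::ab_group_add set \<Rightarrow> 'a set \<Rightarrow> 'a set set"
  where "quotient_space V U = (\<lambda>v. v +o U) ` V"

definition coset_comb ::
  "('k::field \<Rightarrow> 'a::ab_group_add \<Rightarrow> 'a) \<Rightarrow> 'a set \<Rightarrow> ('a set \<Rightarrow> 'k) \<Rightarrow> 'a set set \<Rightarrow> 'a set"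
  where "coset_comb scl U c F = U + (\<Sum>A\<in>F. scl (c A) ` A)"

definition coset_independent ::
  "('k::field \<Rightarrow> 'a::ab_group_add \<Rightarrow> 'a) \<Rightarrow> 'a set \<Rightarrow> 'a set set \<Rightarrow> bool"
  where "coset_independent scl U C \<longleftrightarrow>
    (\<forall>F c. finite F \<and> F \<subseteq> C \<and> coset_comb scl U c F = U \<longrightarrow> (\<forall>A\<in>F. c A = 0))"

definition coset_span ::
  "('k::field \<Rightarrow> 'a::ab_group_add \<Rightarrow> 'a) \<Rightarrow> 'a set \<Rightarrow> 'a set set \<Rightarrow> 'a set set"
  where "coset_span scl U C = {coset_comb scl U c F | c F. finite F \<and> F \<subseteq> C}"

definition quotient_basis ::
  "('k::field \<Rightarrow> 'a::ab_group_add \<Rightarrow> 'a) \<Rightarrow> 'a set \<Rightarrow> 'a set \<Rightarrow> 'a set set \<Rightarrow> bool"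
  where "quotient_basis scl V U C \<longleftrightarrow>
    C \<subseteq> quotient_space V U \<and> coset_independent scl U C \<and>
    coset_span scl U C = quotient_space V U"

definition quotient_dim ::
  "('k::field \<Rightarrow> 'a::ab_group_add \<Rightarrow> 'a) \<Rightarrow> 'a set \<Rightarrow> 'a set \<Rightarrow> nat"
  where "quotient_dim scl V U = card (SOME C. quotient_basis scl V U C)"

text \<open>Distinct elements of \<open>B\<close> are required to have distinct images in the quotient.\<close>

definition images_form_basis ::
  "('k::field \<Rightarrow> 'a::ab_group_add \<Rightarrow> 'a) \<Rightarrow> 'a set \<Rightarrow> 'a set \<Rightarrow> 'a set \<Rightarrow> bool"
  where "images_form_basis scl V U B \<longleftrightarrow>
    inj_on (\<lambda>v. v +o U) B \<and> quotient_basis scl V U ((\<lambda>v. v +o U) ` B)"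

section \<open>Identities, codimensions and exponent\<close>

text \<open>Substitutions are given by homomorphisms; see \<open>free_leibniz_universal\<close>.\<close>

definition T_ideal ::
  "('k::field \<Rightarrow> 'a::ab_group_add \<Rightarrow> 'a) \<Rightarrow> ('a \<Rightarrow> 'a \<Rightarrow> 'a) \<Rightarrow> 'k free_leibniz set"
  where "T_ideal scl mul =
    {f. \<forall>\<phi>. algebra_hom fl_scale fl_mult scl mul \<phi> \<longrightarrow> \<phi> f = 0}"

definition multilinear :: "nat \<Rightarrow> 'k::field free_leibniz set"
  where "multilinear n = module.span fl_scale
    {fl_monomial t | t. distinct (letters t) \<and> set (letters t) = {..<n}}"

definition codim ::
  "('k::field \<Rightarrow> 'a::ab_group_add \<Rightarrow> 'a) \<Rightarrow> ('a \<Rightarrow> 'a \<Rightarrow> 'a) \<Rightarrow> nat \<Rightarrow> nat"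
  where "codim scl mul n =
    quotient_dim fl_scale (multilinear n) (multilinear n \<inter> T_ideal scl mul)"

definition exponent ::
  "('k::field \<Rightarrow> 'a::ab_group_add \<Rightarrow> 'a) \<Rightarrow> ('a \<Rightarrow> 'a \<Rightarrow> 'a) \<Rightarrow> real"
  where "exponent scl mul = lim (\<lambda>n. root n (real (codim scl mul n)))"

section \<open>The algebra and the monomials of the statement\<close>

definition L13_table :: "3 \<Rightarrow> 3 \<Rightarrow> 'k::field ^ 3"
  where "L13_table i j =
    (if i = 3 \<and> j = 3 then axis 1 1
     else if i = 1 \<and> j = 3 then axis 1 1 + axis 2 1
     else 0)"

definition L13_mult :: "'k::field ^ 3 \<Rightarrow> 'k ^ 3 \<Rightarrow> 'k ^ 3"
  where "L13_mult x y = (\<Sum>i\<in>UNIV. \<Sum>j\<in>UNIV. (x $ i * y $ j) *s L13_table i j)"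

lemma L13_mult_basis:
  "L13_mult (axis i 1) (axis j 1) = (L13_table i j :: 'k::field ^ 3)"
  unfolding L13_mult_def sum_3 using exhaust_3[of i] exhaust_3[of j]
  by (auto simp: axis_def)

lemma L13_mult_components:
  "L13_mult x y = vector [(x $ 3 + x $ 1) * y $ 3, x $ 1 * y $ 3, 0]"
  unfolding L13_mult_def sum_3 L13_table_def
  by (simp add: vec_eq_iff forall_3 axis_def vector_3 algebra_simps)

lemma L13_leibniz_algebra:
  "leibniz_algebra (*s) (L13_mult :: 'k::field ^ 3 \<Rightarrow> _)"
  by unfold_locales
    (auto simp: L13_mult_components vec_eq_iff forall_3 vector_3 algebra_simps)

text \<open>
  \<open>block_monomial n j m\<close> is the left-normed product of \<open>m 1\<close> copies of the variable \<open>j 1\<close>,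
  then \<open>m 2\<close> copies of the variable \<open>j 2\<close>, and so on up to \<open>m n\<close> copies of the variable \<open>j n\<close>.
\<close>

definition block_monomial :: "nat \<Rightarrow> (nat \<Rightarrow> nat) \<Rightarrow> (nat \<Rightarrow> nat) \<Rightarrow> 'k::field free_leibniz"
  where "block_monomial n j m =
    left_normed fl_mult (concat (map (\<lambda>i. replicate (m i) (fl_var (j i))) [1..<n + 1]))"

definition admissible :: "nat \<Rightarrow> (nat \<Rightarrow> nat) \<Rightarrow> (nat \<Rightarrow> nat) \<Rightarrow> bool"
  where "admissible n j m \<longleftrightarrow>
    n \<ge> 1 \<and> (\<forall>i\<in>{1..n}. m i \<ge> 1) \<and> strict_mono_on {2..n} j \<and> (\<forall>k\<in>{2..n}. j 1 \<noteq> j k)"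

definition B_L13 :: "'k::field free_leibniz set"
  where "B_L13 = {block_monomial n j m | n j m. admissible n j m}"

definition B_L13_finite :: "nat \<Rightarrow> 'k::field free_leibniz set"
  where "B_L13_finite q = {block_monomial n j m | n j m. admissible n j m \<and>
    (n \<ge> 2 \<and> m 1 > 1 \<longrightarrow> m 2 < q) \<and>
    (n = 1 \<longrightarrow> 1 \<le> m 1 \<and> m 1 \<le> q + 1) \<and>
    (n = 2 \<longrightarrow> (\<forall>i\<in>{1, 2}. 1 \<le> m i \<and> m i \<le> q) \<and> (m 1 = 1 \<and> m 2 = 1 \<longrightarrow> j 1 < j 2)) \<and>
    (n \<ge> 3 \<longrightarrow> 1 \<le> m 1 \<and> m 1 \<le> q \<and> (\<forall>i\<in>{2..n}. 1 \<le> m i \<and> m i < q))}"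

end

(*
  In L13 right multiplication by y only depends on the third coordinate of y, and a product has
  third coordinate 0. Hence f(gh) is always an identity, and a left-normed word with first letter i
  and further letters M (a multiset) takes the value
  ((a_i + c_i) c^M, (a_i + c_i) c^M, 0) when |M| > 1, with a_i in place of a_i + c_i in the second
  component when |M| = 1; here (a_i, b_i, c_i) is substituted for x_i. So T(L13) sees only the pair
  (i, M), and reading off the coefficient of a_i turns linear independence into independence of
  the monomial functions c^M. Over a field with q elements one moreover has c^q = c; the words with
  |M| = 1 are then told apart from the longer ones by the difference of the first two components,
  which is c_i c_j for x_i x_j and 0 for all longer words. This symmetry in i and j is the reason
  why only one of x_i x_j and x_j x_i belongs to the basis.
*)
theory Submission
  imports Defs "HOL-Computational_Algebra.Polynomial"
begin

section \<open>Bases of quotient spaces\<close>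

context vector_space
begin

lemma coset_eq_iff:
  assumes "subspace U"
  shows "v +o U = w +o U \<longleftrightarrow> v - w \<in> U"
proof
  assume "v +o U = w +o U"
  then have "v + 0 \<in> w +o U"
    using subspace_0[OF assms] by (metis set_plus_intro2)
  then show "v - w \<in> U"
    by (auto simp: elt_set_plus_def)
next
  assume vw: "v - w \<in> U"
  show "v +o U = w +o U"
  proof (intro set_eqI iffI)
    fix x assume "x \<in> v +o U"
    then obtain u where "u \<in> U" "x = v + u" by (auto simp: elt_set_plus_def)
    then show "x \<in> w +o U"
      using subspace_add[OF assms vw, of u]
      by (auto simp: elt_set_plus_def intro!: bexI[of _ "v - w + u"])
  next
    fix x assume "x \<in> w +o U"
    then obtain u where "u \<in> U" "x = w + u" by (auto simp: elt_set_plus_def)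
    then show "x \<in> v +o U"
      using subspace_diff[OF assms _ vw, of u]
      by (auto simp: elt_set_plus_def intro!: bexI[of _ "u - (v - w)"])
  qed
qed

lemma coset_eq_subspace_iff:
  assumes "subspace U"
  shows "v +o U = U \<longleftrightarrow> v \<in> U"
  using coset_eq_iff[OF assms, of v 0] by simp

text \<open>For \<open>c = 0\<close> the scaled coset shrinks to \<open>{0}\<close>; the second
  coset then supplies the \<open>U\<close> on the right-hand side.\<close>

lemma scale_coset_plus_coset:
  assumes "subspace U"
  shows "scale c ` (v +o U) + (w +o U) = (scale c v + w) +o U"
proof (intro set_eqI iffI)
  fix x assume "x \<in> scale c ` (v +o U) + (w +o U)"
  then obtain u u' where u: "u \<in> U" "u' \<in> U" "x = scale c (v + u) + (w + u')"
    by (auto simp: elt_set_plus_def set_plus_def)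
  then have "scale c u + u' \<in> U"
    using assms by (simp add: subspace_add subspace_scale)
  then show "x \<in> (scale c v + w) +o U"
    using u by (auto simp: elt_set_plus_def scale_right_distrib algebra_simps
        intro!: bexI[of _ "scale c u + u'"])
next
  fix x assume "x \<in> (scale c v + w) +o U"
  then obtain u where u: "u \<in> U" "x = scale c (v + 0) + (w + u)"
    by (auto simp: elt_set_plus_def add.assoc)
  show "x \<in> scale c ` (v +o U) + (w +o U)"
    unfolding u(2) using u(1) subspace_0[OF assms]
    by (intro set_plus_intro imageI set_plus_intro2)
qed

text \<open>Turns combinations of cosets into combinations of vectors. The summand \<open>U\<close>
  in \<open>coset_comb\<close> starts the induction and makes terms with coefficient 0
  harmless.\<close>

lemma coset_comb_representatives:
  assumes U: "subspace U" and "finite F" and "\<And>A. A \<in> F \<Longrightarrow> r A +o U = A"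
  shows "coset_comb scale U c F = (\<Sum>A\<in>F. scale (c A) (r A)) +o U"
  using assms(2,3)
proof (induction F rule: finite_induct)
  case empty
  then show ?case by (simp add: coset_comb_def)
next
  case (insert A F)
  have "coset_comb scale U c (insert A F) = scale (c A) ` A + coset_comb scale U c F"
    using insert(1,2) by (simp add: coset_comb_def add.left_commute)
  also have "\<dots> = scale (c A) ` (r A +o U) + ((\<Sum>A\<in>F. scale (c A) (r A)) +o U)"
    using insert by simp
  also have "\<dots> = (\<Sum>A\<in>insert A F. scale (c A) (r A)) +o U"
    using insert(1,2) by (simp add: scale_coset_plus_coset[OF U])
  finally show ?case .
qed

text \<open>Relations are indexed by \<open>I\<close> and not by vectors, so two indices with the
  same coset already give a nontrivial relation: the difference of their vectors.\<close>

lemma inj_on_of_relation_free: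
  assumes U: "subspace U"
    and indep: "\<And>F k x. \<lbrakk>finite F; F \<subseteq> I; (\<Sum>x\<in>F. scale (k x) (g x)) \<in> U; x \<in> F\<rbrakk> \<Longrightarrow> k x = 0"
  shows "inj_on (\<lambda>x. g x +o U) I"
proof (rule inj_onI, rule ccontr)
  fix x y assume xy: "x \<in> I" "y \<in> I" "g x +o U = g y +o U" "x \<noteq> y"
  then have "(\<Sum>z\<in>{x, y}. scale (if z = x then 1 else - 1) (g z)) \<in> U"
    using coset_eq_iff[OF U] by simp
  from indep[OF _ _ this, of x] xy show False by auto
qed

text \<open>The criterion behind every basis below. It moves both basis conditions from cosets to
  vectors, where they become absence of relations modulo \<open>U\<close> and spanning together with
  \<open>U\<close>.\<close>

lemma images_form_basis_image:
  assumes U: "subspace U" and V: "subspace V" and UV: "U \<subseteq> V" and gV: "g ` I \<subseteq> V"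
    and indep: "\<And>F k x. \<lbrakk>finite F; F \<subseteq> I; (\<Sum>x\<in>F. scale (k x) (g x)) \<in> U; x \<in> F\<rbrakk> \<Longrightarrow> k x = 0"
    and span: "V \<subseteq> span (g ` I \<union> U)"
  shows "images_form_basis scale V U (g ` I)"
proof -
  let ?q = "\<lambda>v. v +o U"
  have injI: "inj_on (\<lambda>x. ?q (g x)) I"
    by (rule inj_on_of_relation_free[OF U]) (rule indep)
  have injB: "inj_on ?q (g ` I)" and injg: "inj_on g I"
    using injI by (auto simp: inj_on_def)
  \<comment> \<open>Since \<open>g\<close> is injective modulo \<open>U\<close>, each coset in the
    image has a preferred representative; \<open>r\<close> carries coefficients over between vectors
    and cosets.\<close>
  define r where "r A = g (the_inv_into I (\<lambda>x. ?q (g x)) A)" for A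
  have r: "r (?q (g x)) = g x" if "x \<in> I" for x
    using that by (simp add: r_def the_inv_into_f_f[OF injI])
  have comb: "coset_comb scale U c ((\<lambda>x. ?q (g x)) ` F) =
      (\<Sum>x\<in>F. scale (c (?q (g x))) (g x)) +o U"
    if F: "finite F" "F \<subseteq> I" for c F
  proof -
    have "coset_comb scale U c ((\<lambda>x. ?q (g x)) ` F) =
      (\<Sum>A\<in>(\<lambda>x. ?q (g x)) ` F. scale (c A) (r A)) +o U"
      using F r by (intro coset_comb_representatives U) auto
    also have "(\<Sum>A\<in>(\<lambda>x. ?q (g x)) ` F. scale (c A) (r A)) =
      (\<Sum>x\<in>F. scale (c (?q (g x))) (g x))"
      using F r inj_on_subset[OF injI F(2)] by (subst sum.reindex) (auto intro!: sum.cong)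
    finally show ?thesis .
  qed
  have sub: "\<exists>G. finite G \<and> G \<subseteq> I \<and> F = (\<lambda>x. ?q (g x)) ` G"
    if "finite F" "F \<subseteq> ?q ` g ` I" for F
    using finite_subset_image[OF that(1), of "\<lambda>x. ?q (g x)" I] that(2) by (auto simp: image_image)
  have "coset_independent scale U (?q ` g ` I)"
    unfolding coset_independent_def
  proof (intro allI impI ballI, elim conjE)
    fix F c A
    assume F: "finite F" "F \<subseteq> ?q ` g ` I" "coset_comb scale U c F = U" "A \<in> F"
    obtain G where G: "finite G" "G \<subseteq> I" "F = (\<lambda>x. ?q (g x)) ` G"
      using sub[OF F(1,2)] by blast
    have "(\<Sum>x\<in>G. scale (c (?q (g x))) (g x)) \<in> U"
      using F(3) unfolding G(3) comb[OF G(1,2)] coset_eq_subspace_iff[OF U] .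
    from indep[OF G(1,2) this] show "c A = 0"
      using F(4) G(3) by auto
  qed
  moreover have "coset_span scale U (?q ` g ` I) = quotient_space V U"
  proof (intro equalityI subsetI)
    fix A assume "A \<in> coset_span scale U (?q ` g ` I)"
    then obtain c F where F: "A = coset_comb scale U c F" "finite F" "F \<subseteq> ?q ` g ` I"
      by (auto simp: coset_span_def)
    then obtain G where G: "finite G" "G \<subseteq> I" "F = (\<lambda>x. ?q (g x)) ` G"
      using sub[OF F(2,3)] by blast
    have "(\<Sum>x\<in>G. scale (c (?q (g x))) (g x)) \<in> V"
      using gV G(2) by (intro subspace_sum V subspace_scale) auto
    then show "A \<in> quotient_space V U"
      using comb[OF G(1,2)] F G by (auto simp: quotient_space_def)
  next
    fix A assume "A \<in> quotient_space V U"
    then obtain v where v: "v \<in> V" "A = v +o U" by (auto simp: quotient_space_def)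
    then have "v \<in> span (g ` I \<union> U)" using span by blast
    then obtain x u where x: "v = x + u" "x \<in> span (g ` I)" "u \<in> U"
      using span_eq_iff[THEN iffD2, OF U] by (auto simp: span_Un)
    then obtain t c where t: "finite t" "t \<subseteq> g ` I" "x = (\<Sum>a\<in>t. scale (c a) a)"
      unfolding span_explicit by blast
    obtain G where G: "finite G" "G \<subseteq> I" "t = g ` G"
      using finite_subset_image[OF t(1,2)] by blast
    have "v - (\<Sum>y\<in>G. scale (c (r (?q (g y)))) (g y)) = u"
    proof -
      have "(\<Sum>y\<in>G. scale (c (r (?q (g y)))) (g y)) = (\<Sum>y\<in>G. scale (c (g y)) (g y))"
        using G r by (intro sum.cong) auto
      also have "\<dots> = x"
        using t(3) G inj_on_subset[OF injg G(2)] by (simp add: sum.reindex)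
      finally show ?thesis using x by simp
    qed
    then have "A = coset_comb scale U (\<lambda>A. c (r A)) ((\<lambda>x. ?q (g x)) ` G)"
      unfolding comb[OF G(1,2)] v(2) coset_eq_iff[OF U] using x by simp
    then show "A \<in> coset_span scale U (?q ` g ` I)"
      unfolding coset_span_def using G by blast
  qed
  moreover have "?q ` g ` I \<subseteq> quotient_space V U"
    using gV by (auto simp: quotient_space_def)
  ultimately show ?thesis
    using injB by (simp add: images_form_basis_def quotient_basis_def)
qed

section \<open>Dimension of a quotient space\<close>

text \<open>The Steinitz bound for quotients: suitable representatives of \<open>C\<close> are
  independent vectors in the span of finitely many representatives of \<open>D\<close>.\<close>

lemma quotient_basis_card_le:
  assumes U: "subspace U" and C: "quotient_basis scale V U C"
    and D: "quotient_basis scale V U D" "finite D"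
  shows "finite C \<and> card C \<le> card D"
proof -
  define r where "r A = (SOME v. v \<in> V \<and> A = v +o U)" for A
  have r: "r A \<in> V \<and> A = r A +o U" if "A \<in> quotient_space V U" for A
    unfolding r_def by (rule someI_ex) (use that in \<open>auto simp: quotient_space_def\<close>)
  have rC: "r A +o U = A" if "A \<in> C" for A
    using r[of A] C that by (auto simp: quotient_basis_def)
  have rD: "r A +o U = A" if "A \<in> D" for A
    using r[of A] D that by (auto simp: quotient_basis_def)
  \<comment> \<open>Arbitrary representatives of \<open>C\<close> may leave this span by elements of
    \<open>U\<close>, so new ones are read off from the expansions in \<open>D\<close>.\<close>
  have "\<exists>p \<in> span (r ` D). p +o U = A" if "A \<in> C" for A
  proof -
    have "A \<in> coset_span scale U D"
      using that C D by (auto simp: quotient_basis_def)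
    then obtain c F where F: "A = coset_comb scale U c F" "finite F" "F \<subseteq> D"
      by (auto simp: coset_span_def)
    then have "(\<Sum>A\<in>F. scale (c A) (r A)) +o U = A"
      using coset_comb_representatives[OF U F(2), of r c] rD by auto
    moreover have "(\<Sum>A\<in>F. scale (c A) (r A)) \<in> span (r ` D)"
      using F(3) by (intro span_sum span_scale span_base) auto
    ultimately show ?thesis by blast
  qed
  then obtain p where p: "\<And>A. A \<in> C \<Longrightarrow> p A \<in> span (r ` D)" "\<And>A. A \<in> C \<Longrightarrow> p A +o U = A"
    by metis
  then have inj: "inj_on p C"
    by (metis inj_onI)
  have "independent (p ` C)"
    unfolding independent_explicit_module
  proof (intro allI impI)
    fix t u v
    assume t: "finite t" "t \<subseteq> p ` C" "(\<Sum>v\<in>t. scale (u v) v) = 0" "v \<in> t"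
    obtain F where F: "finite F" "F \<subseteq> C" "t = p ` F"
      using finite_subset_image[OF t(1,2)] by blast
    have "coset_comb scale U (\<lambda>A. u (p A)) F = (\<Sum>A\<in>F. scale (u (p A)) (p A)) +o U"
      using F p by (intro coset_comb_representatives U) auto
    also have "(\<Sum>A\<in>F. scale (u (p A)) (p A)) = 0"
      using t(3) F inj_on_subset[OF inj F(2)] by (simp add: sum.reindex)
    finally have "coset_comb scale U (\<lambda>A. u (p A)) F = U" by simp
    then have "\<forall>A\<in>F. u (p A) = 0"
      using C F(1,2) unfolding quotient_basis_def coset_independent_def by blast
    then show "u v = 0" using t(4) F(3) by auto
  qed
  moreover have "p ` C \<subseteq> span (r ` D)" using p by auto
  ultimately have "finite (p ` C) \<and> card (p ` C) \<le> card (r ` D)"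
    using D(2) by (intro independent_span_bound) auto
  then show ?thesis
    using card_image[OF inj] finite_image_iff[OF inj] card_image_le[OF D(2), of r] by auto
qed

text \<open>\<open>quotient_dim\<close> counts an arbitrarily chosen basis, so all bases have to be
  equally large; this is the previous bound applied in both directions.\<close>

lemma quotient_dim_eq_card:
  assumes U: "subspace U" and B: "images_form_basis scale V U B" "finite B"
  shows "quotient_dim scale V U = card B"
proof -
  let ?D = "(\<lambda>v. v +o U) ` B"
  have D: "quotient_basis scale V U ?D" "finite ?D" "card ?D = card B"
    using B by (auto simp: images_form_basis_def card_image)
  have "card C = card ?D" if "quotient_basis scale V U C" for C
    using quotient_basis_card_le[OF U that D(1,2)] quotient_basis_card_le[OF U D(1) that]
    by simp
  then show ?thesis
    unfolding quotient_dim_def using D by (metis (no_types, lifting) someI_ex)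
qed

end

section \<open>Polynomial functions\<close>

lemma finite_field_card_ge_2:
  assumes "finite (UNIV :: 'k::field set)"
  shows "2 \<le> CARD('k)"
proof -
  have "card {0, 1 :: 'k} \<le> CARD('k)" using assms by (intro card_mono) auto
  then show ?thesis by simp
qed

text \<open>Multiplication by a nonzero \<open>x\<close> permutes the nonzero elements; comparing
  their products before and after gives x^(q-1) = 1.\<close>

lemma finite_field_power_card:
  fixes x :: "'k::field"
  assumes "finite (UNIV :: 'k set)"
  shows "x ^ CARD('k) = x"
proof (cases "x = 0")
  case True
  then show ?thesis using assms by (simp add: finite_UNIV_card_ge_0)
next
  case False
  let ?S = "UNIV - {0 :: 'k}"
  have "(\<Prod>y\<in>?S. x * y) = (\<Prod>y\<in>?S. y)"
    by (rule prod.reindex_bij_witness[of _ "\<lambda>y. y / x" "\<lambda>y. x * y"]) (use False in auto)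
  then have "x ^ card ?S * \<Prod>?S = \<Prod>?S"
    by (simp add: prod.distrib)
  moreover have "\<Prod>?S \<noteq> 0"
    using assms by (simp add: prod_zero_iff)
  ultimately have "x ^ card ?S = 1" by simp
  moreover have "CARD('k) = Suc (card ?S)"
    using card_Suc_Diff1[OF assms UNIV_I] by metis
  ultimately show ?thesis by (metis mult.right_neutral power_Suc)
qed

text \<open>Otherwise the whole field would consist of at most \<open>degree p\<close>
  roots.\<close>

lemma poly_zero_everywhere:
  fixes p :: "'k::field poly"
  assumes "\<And>t. poly p t = 0" and "finite (UNIV :: 'k set) \<Longrightarrow> degree p < CARD('k)"
  shows "p = 0"
proof (rule ccontr)
  assume "p \<noteq> 0"
  then have "finite {t. poly p t = 0}" "card {t. poly p t = 0} \<le> degree p"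
    by (auto simp: poly_roots_finite card_poly_roots_bound)
  then show False using assms by auto
qed

text \<open>Induction on the set of occurring variables. With all values but that of one variable
  \<open>v\<close> fixed, the relation is a polynomial in that value of degree below the field size,
  so each coefficient vanishes; a coefficient is a relation in the remaining variables.\<close>

lemma monomial_functions_independent:
  fixes k :: "'a multiset \<Rightarrow> 'k::field"
  assumes "finite F"
    and "\<And>M j. \<lbrakk>M \<in> F; finite (UNIV :: 'k set)\<rbrakk> \<Longrightarrow> count M j < CARD('k)"
    and "\<And>c. (\<Sum>M\<in>F. k M * (\<Prod>j\<in>#M. c j)) = 0"
    and "M \<in> F"
  shows "k M = 0"
proof -
  define X where "X = (\<Union>M\<in>F. set_mset M)"
  have "finite X" "\<And>M. M \<in> F \<Longrightarrow> set_mset M \<subseteq> X"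
    using assms(1) by (auto simp: X_def)
  then show ?thesis
    using assms
  proof (induction X arbitrary: F k M rule: finite_induct)
    case empty
    have "F = {{#}}" "M = {#}"
      using empty(1,5) by auto
    then show ?case using empty(4) by simp
  next
    case (insert v X)
    let ?r = "filter_mset (\<lambda>j. j \<noteq> v)"
    define e where "e = count M v"
    \<comment> \<open>The multisets in which \<open>v\<close> has the same exponent as in
      \<open>M\<close>; they stay distinct when \<open>v\<close> is removed.\<close>
    define F' where "F' = {N \<in> F. count N v = e}"
    have split: "N = ?r N + replicate_mset (count N v) v" for N
      by (rule multiset_eqI) auto
    have inj: "inj_on ?r F'"
      by (rule inj_onI) (metis (mono_tags, lifting) F'_def mem_Collect_eq split)
    have sum0: "(\<Sum>N\<in>F'. k N * (\<Prod>j\<in>#?r N. c j)) = 0" for c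
    proof -
      define p where "p = (\<Sum>N\<in>F. monom (k N * (\<Prod>j\<in>#?r N. c j)) (count N v))"
      have coeff: "coeff p d = (\<Sum>N\<in>{N \<in> F. count N v = d}. k N * (\<Prod>j\<in>#?r N. c j))" for d
        unfolding p_def coeff_sum using insert(5)
        by (auto simp: sum.If_cases Int_def intro!: sum.cong)
      have "poly p t = 0" for t
      proof -
        have "poly p t = (\<Sum>N\<in>F. k N * (\<Prod>j\<in>#N. (c(v := t)) j))"
          unfolding p_def poly_sum
        proof (intro sum.cong refl)
          fix N
          have "(\<Prod>j\<in>#N. (c(v := t)) j) =
              (\<Prod>j\<in>#?r N. (c(v := t)) j) * (\<Prod>j\<in>#replicate_mset (count N v) v. (c(v := t)) j)"
            by (subst split[of N]) (simp del: fun_upd_apply)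
          also have "(\<Prod>j\<in>#?r N. (c(v := t)) j) = (\<Prod>j\<in>#?r N. c j)"
            by (intro arg_cong[of _ _ prod_mset] image_mset_cong) auto
          finally show "poly (monom (k N * (\<Prod>j\<in>#?r N. c j)) (count N v)) t =
              k N * (\<Prod>j\<in>#N. (c(v := t)) j)"
            by (simp add: poly_monom)
        qed
        then show ?thesis using insert(7) by simp
      qed
      moreover have "degree p < CARD('k)" if "finite (UNIV :: 'k set)"
      proof (cases "p = 0")
        case True
        then show ?thesis using that by (simp add: finite_UNIV_card_ge_0)
      next
        case False
        then have "coeff p (degree p) \<noteq> 0" by simp
        \<comment> \<open>The leading exponent occurs in a member of \<open>F\<close>, so it obeys
          the bound on multiplicities.\<close>
        then have "\<exists>N\<in>F. count N v = degree p"
          unfolding coeff by (metis (mono_tags, lifting) emptyE mem_Collect_eq equals0I sum.empty)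
        then show ?thesis using insert(6) that by metis
      qed
      ultimately have "p = 0" by (rule poly_zero_everywhere)
      then show ?thesis using coeff[of e] by (simp add: F'_def)
    qed
    define k' where "k' N = k (N + replicate_mset e v)" for N
    have k': "k' (?r N) = k N" if "N \<in> F'" for N
      using split[of N] that by (simp add: k'_def F'_def)
    have "k' (?r M) = 0"
    proof (rule insert.IH)
      show "set_mset N \<subseteq> X" if "N \<in> ?r ` F'" for N
        using that insert(4) by (fastforce simp: F'_def)
      show "finite (?r ` F')" using insert(5) by (simp add: F'_def)
      show "count N j < CARD('k)" if N: "N \<in> ?r ` F'" "finite (UNIV :: 'k set)" for N j
      proof -
        obtain N' where "N' \<in> F" "N = ?r N'" using N(1) by (auto simp: F'_def)
        then have "count N j \<le> count N' j" "count N' j < CARD('k)"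
          using insert(6) N(2) by auto
        then show ?thesis by simp
      qed
      show "(\<Sum>N\<in>?r ` F'. k' N * (\<Prod>j\<in>#N. c j)) = 0" for c
        using sum0[of c] k' by (simp add: sum.reindex[OF inj])
      show "?r M \<in> ?r ` F'" using insert(8) by (simp add: F'_def e_def)
    qed
    then show ?case using k'[of M] insert(8) by (simp add: F'_def e_def)
  qed
qed

section \<open>Values of words in the algebra\<close>

interpretation fl: leibniz_algebra "fl_scale :: 'k::field \<Rightarrow> _" fl_mult
  by (rule free_leibniz_algebra)

definition L13_eval :: "(nat \<Rightarrow> 'k::field ^ 3) \<Rightarrow> 'k free_leibniz \<Rightarrow> 'k ^ 3"
  where "L13_eval \<rho> = (THE \<phi>. algebra_hom fl_scale fl_mult (*s) L13_mult \<phi> \<and> (\<forall>i. \<phi> (fl_var i) = \<rho> i))"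

lemma L13_eval_hom: "algebra_hom fl_scale fl_mult (*s) L13_mult (L13_eval \<rho>)"
  and L13_eval_var [simp]: "L13_eval \<rho> (fl_var i) = \<rho> i"
  using theI'[OF leibniz_algebra.free_leibniz_universal[OF L13_leibniz_algebra, of \<rho>]]
  unfolding L13_eval_def[symmetric] by auto

lemma L13_eval_add [simp]: "L13_eval \<rho> (f + g) = L13_eval \<rho> f + L13_eval \<rho> g"
  and L13_eval_scale [simp]: "L13_eval \<rho> (fl_scale k f) = k *s L13_eval \<rho> f"
  and L13_eval_mult [simp]: "L13_eval \<rho> (fl_mult f g) = L13_mult (L13_eval \<rho> f) (L13_eval \<rho> g)"
  using L13_eval_hom[of \<rho>] by (auto simp: algebra_hom_def Vector_Spaces.linear_iff)

lemma L13_eval_zero [simp]: "L13_eval \<rho> 0 = 0"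
  using L13_eval_scale[of \<rho> 0 0] by (simp del: L13_eval_scale)

lemma L13_eval_diff [simp]: "L13_eval \<rho> (f - g) = L13_eval \<rho> f - L13_eval \<rho> g"
  by (metis L13_eval_add add_diff_cancel_right' diff_add_cancel)

lemma L13_eval_sum: "L13_eval \<rho> (sum f A) = (\<Sum>x\<in>A. L13_eval \<rho> (f x))"
  by (induction A rule: infinite_finite_induct) auto

abbreviation T_L13 :: "'k::field free_leibniz set"
  where "T_L13 \<equiv> T_ideal (*s) (L13_mult :: 'k ^ 3 \<Rightarrow> 'k ^ 3 \<Rightarrow> 'k ^ 3)"

text \<open>By uniqueness in the universal property, every homomorphism is the evaluation at its own
  values on the variables.\<close>

lemma T_L13_iff: "f \<in> T_L13 \<longleftrightarrow> (\<forall>\<rho>. L13_eval \<rho> f = 0)"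
proof
  assume "f \<in> T_L13"
  then show "\<forall>\<rho>. L13_eval \<rho> f = 0"
    using L13_eval_hom unfolding T_ideal_def by blast
next
  assume f: "\<forall>\<rho>. L13_eval \<rho> f = 0"
  have "\<phi> f = 0" if "algebra_hom fl_scale fl_mult (*s) L13_mult \<phi>" for \<phi>
  proof -
    have "\<phi> = L13_eval (\<lambda>i. \<phi> (fl_var i))"
      using that L13_eval_hom[of "\<lambda>i. \<phi> (fl_var i)"] L13_eval_var[of "\<lambda>i. \<phi> (fl_var i)"]
        leibniz_algebra.free_leibniz_universal[OF L13_leibniz_algebra, of "\<lambda>i. \<phi> (fl_var i)"]
      by blast
    then show ?thesis using f by metis
  qed
  then show "f \<in> T_L13" by (simp add: T_ideal_def)
qed

lemma subspace_T_L13: "fl.subspace T_L13"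
  unfolding fl.subspace_def by (auto simp: T_L13_iff)

section \<open>Left-normed words and their values\<close>

definition fl_word :: "nat list \<Rightarrow> 'k::field free_leibniz"
  where "fl_word w = left_normed fl_mult (map fl_var w)"

lemma fl_word_single: "fl_word [i] = fl_var i"
  by (simp add: fl_word_def left_normed_def)

lemma fl_word_snoc: "w \<noteq> [] \<Longrightarrow> fl_word (w @ [j]) = fl_mult (fl_word w) (fl_var j)"
  by (cases w) (auto simp: fl_word_def left_normed_def)

lemma fl_monomial_Prod: "fl_monomial (Prod s t) = fl_mult (fl_monomial s) (fl_monomial t)"
  by (simp add: fl_monomial.abs_eq fl_mult.abs_eq na_mult_single)

lemma letters_nonempty: "letters t \<noteq> []"
  by (induction t) auto

text \<open>The first multiplication by an element with third coordinate y sends (a, b, c) to ((a +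
  c) y, a y, 0). Each later one copies the first component into the second, so the two differ in
  form only when there is exactly one further letter.\<close>

lemma L13_eval_word:
  fixes \<rho> :: "nat \<Rightarrow> 'k::field ^ 3"
  shows "L13_eval \<rho> (fl_word (i # w)) =
    (if w = [] then \<rho> i
     else let p = (\<Prod>j\<in>#mset w. \<rho> j $ 3) in
       vector [(\<rho> i $ 1 + \<rho> i $ 3) * p, (\<rho> i $ 1 + (if length w = 1 then 0 else \<rho> i $ 3)) * p, 0])"
proof (induction w rule: rev_induct)
  case Nil
  then show ?case by (simp add: fl_word_single)
next
  case (snoc j w)
  have "L13_eval \<rho> (fl_word (i # w @ [j])) = L13_mult (L13_eval \<rho> (fl_word (i # w))) (\<rho> j)"
    by (subst fl_word_snoc[of "i # w" j, simplified]) simp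
  then show ?case
    using snoc by (auto simp: L13_mult_components vec_eq_iff forall_3 vector_3 Let_def algebra_simps)
qed

text \<open>A right factor that is itself a product has third coordinate 0 under every substitution,
  so the monomial is an identity. If no such factor occurs, the monomial is already
  left-normed.\<close>

lemma fl_monomial_cases:
  "fl_monomial t \<in> (T_L13 :: 'k::field free_leibniz set) \<or>
    fl_monomial t = (fl_word (letters t) :: 'k free_leibniz)"
proof (induction t)
  case (Gen i)
  then show ?case by (simp add: fl_word_single fl_var_def)
next
  case (Prod s t)
  show ?case
  proof (cases t)
    case (Gen j)
    from Prod(1) show ?thesis
    proof
      assume "fl_monomial s \<in> (T_L13 :: 'k free_leibniz set)"
      then have "fl_monomial (Prod s t) \<in> (T_L13 :: 'k free_leibniz set)"
        by (simp add: T_L13_iff fl_monomial_Prod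
            leibniz_algebra.mult_zero_left[OF L13_leibniz_algebra])
      then show ?thesis by simp
    next
      assume "fl_monomial s = (fl_word (letters s) :: 'k free_leibniz)"
      then show ?thesis
        by (simp add: Gen fl_monomial_Prod fl_word_snoc[OF letters_nonempty] fl_var_def)
    qed
  next
    case (Prod u v)
    then have "fl_monomial (nmon.Prod s t) \<in> (T_L13 :: 'k free_leibniz set)"
      by (simp add: T_L13_iff fl_monomial_Prod L13_mult_components vec_eq_iff forall_3 vector_3)
    then show ?thesis by simp
  qed
qed

text \<open>Serves to place words in \<open>multilinear n\<close>, which is spanned by
  monomials.\<close>

lemma fl_word_eq_monomial: "w \<noteq> [] \<Longrightarrow> \<exists>t. letters t = w \<and> fl_word w = fl_monomial t"
proof (induction w rule: rev_nonempty_induct)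
  case (single i)
  then show ?case by (intro exI[of _ "Gen i"]) (simp add: fl_word_single fl_var_def)
next
  case (snoc i w)
  then obtain t where "letters t = w" "fl_word w = (fl_monomial t :: 'a free_leibniz)" by blast
  then show ?case
    using snoc(1)
    by (intro exI[of _ "Prod t (Gen i)"]) (simp add: fl_word_snoc fl_monomial_Prod fl_var_def)
qed

lemma fl_span_monomials:
  "fl.span (range fl_monomial) = (UNIV :: 'k::field free_leibniz set)"
proof -
  have "abs_free_leibniz p \<in> fl.span (range fl_monomial)" for p :: "'k nonassoc"
  proof (induction p rule: nonassoc_induct)
    case (single t c)
    have "abs_free_leibniz (Poly_Mapping.single t c) = fl_scale c (fl_monomial t)"
      by (subst na_single_decomp) (simp add: fl_monomial.abs_eq fl_scale.abs_eq)
    then show ?case by (simp add: fl.span_scale fl.span_base)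
  next
    case (sum p q)
    then show ?case by (simp add: fl.span_add flip: plus_free_leibniz.abs_eq)
  qed
  then have "f \<in> fl.span (range fl_monomial)" for f :: "'k free_leibniz"
    by (induction f rule: free_leibniz.abs_induct)
  then show ?thesis by blast
qed

text \<open>
  The relatively free algebra sees of a word only its first letter and the multiset of its
  remaining letters; the representative chosen here is the one that matches
  \<^const>\<open>block_monomial\<close>.
\<close>

definition canonical_word :: "nat \<times> nat multiset \<Rightarrow> nat list"
  where "canonical_word = (\<lambda>(i, M). i # replicate (count M i) i @
    sorted_list_of_multiset (filter_mset (\<lambda>j. j \<noteq> i) M))"

definition canonical_monomial :: "nat \<times> nat multiset \<Rightarrow> 'k::field free_leibniz"
  where "canonical_monomial x = fl_word (canonical_word x)"

lemma canonical_word_Cons: "\<exists>w. canonical_word (i, M) = i # w \<and> mset w = M"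
  by (auto simp: canonical_word_def intro!: multiset_eqI)

lemma L13_eval_canonical:
  fixes \<rho> :: "nat \<Rightarrow> 'k::field ^ 3"
  shows "L13_eval \<rho> (canonical_monomial (i, M)) =
    (if M = {#} then \<rho> i
     else let p = (\<Prod>j\<in>#M. \<rho> j $ 3) in
       vector [(\<rho> i $ 1 + \<rho> i $ 3) * p, (\<rho> i $ 1 + (if size M = 1 then 0 else \<rho> i $ 3)) * p, 0])"
proof -
  obtain w where w: "canonical_word (i, M) = i # w" "mset w = M"
    using canonical_word_Cons by blast
  then have "w = [] \<longleftrightarrow> M = {#}" "length w = size M" by auto
  then show ?thesis
    using w by (simp add: canonical_monomial_def L13_eval_word)
qed

lemma L13_eval_canonical_1:
  "L13_eval \<rho> (canonical_monomial (i, M)) $ 1 =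
    (\<rho> i $ 1 + (if M = {#} then 0 else \<rho> i $ 3)) * (\<Prod>j\<in>#M. \<rho> j $ 3)"
  by (simp add: L13_eval_canonical Let_def vector_3)

lemma word_canonical_cong:
  "fl_word (i # w) - canonical_monomial (i, mset w) \<in> T_L13"
  by (simp add: T_L13_iff L13_eval_canonical L13_eval_word Let_def)

text \<open>From two further letters on, the value depends on the multiset only through its monomial
  function. With a single further letter the second component has another form.\<close>

lemma canonical_cong:
  assumes "size M \<ge> 2" "size N \<ge> 2"
    and "\<And>c :: nat \<Rightarrow> 'k::field. (\<Prod>j\<in>#M. c j) = (\<Prod>j\<in>#N. c j)"
  shows "canonical_monomial (i, M) - canonical_monomial (i, N) \<in> (T_L13 :: 'k free_leibniz set)"
proof -
  have "M \<noteq> {#}" "N \<noteq> {#}" using assms(1,2) by auto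
  then show ?thesis
    using assms(1,2) assms(3)[of "\<lambda>j. \<rho> j $ 3" for \<rho> :: "nat \<Rightarrow> 'k ^ 3"]
    by (simp add: T_L13_iff L13_eval_canonical Let_def)
qed

text \<open>
  The first components are affine in the first coordinates of the substituted elements, so the
  relations split according to the leading variable.
\<close>

lemma relation_leading_variable:
  fixes k :: "nat \<times> nat multiset \<Rightarrow> 'k::field"
  assumes "finite F" and T: "(\<Sum>x\<in>F. fl_scale (k x) (canonical_monomial x)) \<in> T_L13"
  shows "(\<Sum>M\<in>{M. (i, M) \<in> F}. k (i, M) * (\<Prod>j\<in>#M. c j)) = 0"
proof -
  define \<rho> :: "'k \<Rightarrow> nat \<Rightarrow> 'k ^ 3"
    where "\<rho> t j = vector [if j = i then t else 0, 0, c j]" for t j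
  define S where "S t = (\<Sum>x\<in>F. k x * L13_eval (\<rho> t) (canonical_monomial x) $ 1)" for t
  have "S t = 0" for t
    using T[unfolded T_L13_iff, rule_format, of "\<rho> t"]
    by (simp add: S_def L13_eval_sum vec_eq_iff)
  \<comment> \<open>Only the first coordinate of the variable \<open>i\<close> changes between the
    two substitutions, so all words with another leading variable, and all third-coordinate
    contributions of the leading letter, cancel.\<close>
  then have "0 = S 1 - S 0" by simp
  also have "\<dots> = (\<Sum>x\<in>F. k x * (if fst x = i then \<Prod>j\<in>#snd x. c j else 0))"
    unfolding S_def sum_subtractf[symmetric]
    by (intro sum.cong refl)
      (auto simp: L13_eval_canonical_1 \<rho>_def vector_3 algebra_simps split: prod.splits
        cong: if_cong)
  also have "\<dots> = (\<Sum>x\<in>{x \<in> F. fst x = i}. k x * (\<Prod>j\<in>#snd x. c j))"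
    using assms(1) by (intro sum.mono_neutral_cong_right) auto
  also have "\<dots> = (\<Sum>M\<in>{M. (i, M) \<in> F}. k (i, M) * (\<Prod>j\<in>#M. c j))"
    by (rule sum.reindex_bij_witness[of _ "Pair i" snd]) auto
  finally show ?thesis by simp
qed

lemma finite_pair_section: "finite F \<Longrightarrow> finite {M. (i, M) \<in> F}"
  by (rule finite_subset[of _ "snd ` F"]) force+

text \<open>For each leading variable the relation becomes one between monomial functions, and the
  exponent bound makes those independent over a finite field.\<close>

lemma canonical_independent:
  fixes k :: "nat \<times> nat multiset \<Rightarrow> 'k::field"
  assumes F: "finite F" "(\<Sum>x\<in>F. fl_scale (k x) (canonical_monomial x)) \<in> T_L13" "x \<in> F"
    and small: "\<And>i M j. \<lbrakk>(i, M) \<in> F; finite (UNIV :: 'k set)\<rbrakk> \<Longrightarrow> count M j < CARD('k)"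
  shows "k x = 0"
proof -
  obtain i M where x: "x = (i, M)" by (cases x)
  have "k (i, M) = 0"
    by (rule monomial_functions_independent[of "{M. (i, M) \<in> F}" "\<lambda>M. k (i, M)"])
      (use F x small finite_pair_section relation_leading_variable[OF F(1,2)] in auto)
  then show ?thesis using x by simp
qed

text \<open>The set \<open>U\<close> is left open because the lemma is applied both with all
  identities and with the multilinear ones only.\<close>

lemma monomial_in_span:
  fixes B U :: "'k::field free_leibniz set"
  assumes "canonical_monomial (hd (letters t), mset (tl (letters t))) \<in> fl.span (B \<union> U)"
    and "fl_monomial t \<in> (T_L13 :: 'k free_leibniz set) \<Longrightarrow> fl_monomial t \<in> U"
    and "fl_word (letters t) - canonical_monomial (hd (letters t), mset (tl (letters t))) \<in> U"
  shows "fl_monomial t \<in> fl.span (B \<union> U)"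
proof (cases "fl_monomial t \<in> (T_L13 :: 'k free_leibniz set)")
  case True
  then show ?thesis using assms(2) by (simp add: fl.span_base)
next
  case False
  then have "fl_monomial t = (fl_word (letters t) :: 'k free_leibniz)"
    using fl_monomial_cases by blast
  then show ?thesis
    using fl.span_add[OF fl.span_base[of _ "B \<union> U"] assms(1)] assms(3) by fastforce
qed

lemma UNIV_spanned:
  assumes "\<And>x. canonical_monomial x \<in> fl.span (B \<union> T_L13)"
  shows "UNIV \<subseteq> fl.span (B \<union> T_L13)"
proof -
  have "fl_word (letters t) - canonical_monomial (hd (letters t), mset (tl (letters t))) \<in> T_L13" for t
    using word_canonical_cong[of "hd (letters t)" "tl (letters t)"] letters_nonempty by simp
  then have "range fl_monomial \<subseteq> fl.span (B \<union> T_L13)"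
    using assms by (auto intro!: monomial_in_span)
  then show ?thesis
    using fl.span_minimal[OF _ fl.subspace_span] fl_span_monomials by metis
qed

section \<open>Basis over an infinite field\<close>

lemma images_form_basis_infinite:
  assumes "infinite (UNIV :: 'k::field set)"
  shows "images_form_basis fl_scale UNIV (T_L13 :: 'k free_leibniz set) (range canonical_monomial)"
proof (rule fl.images_form_basis_image)
  show "UNIV \<subseteq> fl.span (range canonical_monomial \<union> (T_L13 :: 'k free_leibniz set))"
    by (intro UNIV_spanned fl.span_base) auto
  show "k x = 0" if "finite F" "(\<Sum>x\<in>F. fl_scale (k x) (canonical_monomial x)) \<in> (T_L13 :: 'k free_leibniz set)"
    "x \<in> F" for F k x
    using that assms by (intro canonical_independent) auto
qed (use subspace_T_L13 in auto)

section \<open>Codimensions\<close>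

lemma codim_L13: "codim (*s) (L13_mult :: 'k::field ^ 3 \<Rightarrow> 'k ^ 3 \<Rightarrow> 'k ^ 3) n = n"
proof -
  let ?V = "multilinear n :: 'k free_leibniz set"
  let ?U = "?V \<inter> T_L13"
  \<comment> \<open>In a multilinear word the leading variable determines the multiset of the
    others, so there is one canonical monomial for each of the \<open>n\<close> variables.\<close>
  define key where "key i = (i, mset_set ({..<n} - {i}))" for i
  define g :: "nat \<Rightarrow> 'k free_leibniz" where "g i = canonical_monomial (key i)" for i
  have V: "fl.subspace ?V" by (simp add: multilinear_def)
  have U: "fl.subspace ?U" using V subspace_T_L13 by (rule fl.subspace_inter)
  have word_V: "fl_word w \<in> ?V" if w: "distinct w" "set w = {..<n}" "w \<noteq> []" for w
  proof -
    obtain t where "letters t = w" "fl_word w = (fl_monomial t :: 'k free_leibniz)"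
      using fl_word_eq_monomial[OF w(3)] by blast
    then show ?thesis
      using w unfolding multilinear_def by (auto intro: fl.span_base)
  qed
  have g_V: "g i \<in> ?V" if "i < n" for i
  proof -
    obtain w where w: "canonical_word (key i) = i # w" "mset w = mset_set ({..<n} - {i})"
      using canonical_word_Cons unfolding key_def by blast
    then have "set w = {..<n} - {i}" "distinct w"
      by (metis finite_Diff finite_lessThan finite_set_mset_mset_set set_mset_mset)
        (metis w(2) finite_Diff finite_lessThan count_mset_set(1) count_mset_set(3) distinct_count_atmost_1
          finite_set_mset_mset_set set_mset_mset)
    then show ?thesis
      unfolding g_def canonical_monomial_def w(1) using that by (intro word_V) auto
  qed
  have indep: "k i = 0" if F: "finite F" "F \<subseteq> {..<n}"
    "(\<Sum>x\<in>F. fl_scale (k x) (g x)) \<in> ?U" "i \<in> F" for F k i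
  proof -
    \<comment> \<open>The first component of \<open>key i\<close> is \<open>i\<close>, so
      \<open>fst\<close> turns coefficients on indices into coefficients on keys.\<close>
    have "(\<lambda>x. k (fst x)) (key i) = 0"
    proof (rule canonical_independent[of "key ` F"])
      have "inj_on key F" by (auto simp: key_def inj_on_def)
      then show "(\<Sum>x\<in>key ` F. fl_scale (k (fst x)) (canonical_monomial x)) \<in> T_L13"
        using F(3) by (simp add: sum.reindex g_def) (simp add: key_def)
      show "count M j < CARD('k)" if M: "(i, M) \<in> key ` F" "finite (UNIV :: 'k set)" for i M j
      proof -
        \<comment> \<open>All exponents are at most 1, hence below the size of any field; this is
          why the codimensions do not depend on the field.\<close>
        have "2 \<le> CARD('k)" by (rule finite_field_card_ge_2[OF M(2)])
        moreover have "count M j \<le> 1" using M(1) by (auto simp: key_def count_mset_set')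
        ultimately show ?thesis by simp
      qed
    qed (use F in auto)
    then show ?thesis by (simp add: key_def)
  qed
  have "images_form_basis fl_scale ?V ?U (g ` {..<n})"
  proof (rule fl.images_form_basis_image[OF U V])
    have "fl_monomial t \<in> fl.span (g ` {..<n} \<union> ?U)"
      if t: "distinct (letters t)" "set (letters t) = {..<n}" for t
    proof (rule monomial_in_span)
      obtain i w where w: "letters t = i # w" using letters_nonempty by (cases "letters t") auto
      have "mset w = mset_set ({..<n} - {i})"
        using t w by (metis Diff_insert_absorb distinct.simps(2) list.simps(15) mset_set_set)
      then have key: "(hd (letters t), mset (tl (letters t))) = key i" and i: "i < n"
        using w t by (auto simp: key_def)
      then show "canonical_monomial (hd (letters t), mset (tl (letters t))) \<in> fl.span (g ` {..<n} \<union> ?U)"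
        unfolding key by (auto simp flip: g_def intro: fl.span_base)
      show "fl_word (letters t) - canonical_monomial (hd (letters t), mset (tl (letters t))) \<in> ?U"
        using word_canonical_cong[of i w] fl.subspace_diff[OF V word_V[OF t] g_V[OF i]] w
        unfolding key by (auto simp: g_def simp flip: key)
      show "fl_monomial t \<in> ?U" if "fl_monomial t \<in> (T_L13 :: 'k free_leibniz set)"
        using that t unfolding multilinear_def by (auto intro: fl.span_base)
    qed
    then show "?V \<subseteq> fl.span (g ` {..<n} \<union> ?U)"
      unfolding multilinear_def
      by (intro fl.span_minimal fl.subspace_span) (auto simp: multilinear_def)
  qed (use g_V indep in auto)
  then have "quotient_dim fl_scale ?V ?U = card (g ` {..<n})"
    by (intro fl.quotient_dim_eq_card[OF U]) auto
  moreover have "inj_on g {..<n}"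
    using fl.inj_on_of_relation_free[OF U, of "{..<n}" g] indep by (auto simp: inj_on_def)
  ultimately show ?thesis
    by (simp add: codim_def card_image)
qed

section \<open>Block monomials and the finite case\<close>

text \<open>The leading letter of the block word and the multiset of its other letters; the first
  block loses one copy to the leading position.\<close>

definition block_key :: "nat \<Rightarrow> (nat \<Rightarrow> nat) \<Rightarrow> (nat \<Rightarrow> nat) \<Rightarrow> nat \<times> nat multiset"
  where "block_key n j m =
    (j 1, replicate_mset (m 1 - 1) (j 1) + (\<Sum>k\<in>{2..n}. replicate_mset (m k) (j k)))"

lemma mset_concat_replicate:
  "mset (concat (map (\<lambda>k. replicate (m k) (j k)) [a..<b])) =
    (\<Sum>k\<in>{a..<b}. replicate_mset (m k) (j k))"
  by (simp add: mset_concat comp_def interv_sum_list_conv_sum_set_nat del: upt_Suc)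

text \<open>The blocks after the first have increasing letters, so sorting recovers their
  concatenation from its multiset.\<close>

lemma sorted_concat_replicate:
  fixes j :: "nat \<Rightarrow> 'a::linorder"
  assumes "mono_on {a..<b} j"
  shows "sorted (concat (map (\<lambda>k. replicate (m k) (j k)) [a..<b]))"
  using assms
proof (induction b)
  case (Suc b)
  then have "sorted (concat (map (\<lambda>k. replicate (m k) (j k)) [a..<b]))"
    by (intro Suc.IH mono_on_subset[OF Suc.prems]) auto
  then show ?case
    using Suc.prems by (auto simp: sorted_append intro: mono_onD)
qed simp

lemma admissible_inj_on:
  assumes "admissible n j m"
  shows "inj_on j {1..n}"
proof -
  have "strict_mono_on {2..n} j" "j 1 \<notin> j ` {2..n}" "{1..n} = insert 1 {2..n}"
    using assms by (auto simp: admissible_def)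
  then show ?thesis
    using strict_mono_on_imp_inj_on by (auto simp: inj_on_insert)
qed

lemma block_key_count:
  assumes "admissible n j m"
  shows "count (snd (block_key n j m)) (j 1) = m 1 - 1"
    and "k \<in> {2..n} \<Longrightarrow> count (snd (block_key n j m)) (j k) = m k"
proof -
  have count: "count (snd (block_key n j m)) x =
      (if x = j 1 then m 1 - 1 else 0) + (\<Sum>l\<in>{2..n}. if x = j l then m l else 0)" for x
    by (simp add: block_key_def count_sum)
  have ne: "j 1 \<noteq> j l" if "l \<in> {2..n}" for l
    using assms that by (simp add: admissible_def)
  then show "count (snd (block_key n j m)) (j 1) = m 1 - 1"
    unfolding count by (simp add: sum.neutral)
  assume k: "k \<in> {2..n}"
  have "(j k = j l) = (k = l)" if "l \<in> {2..n}" for l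
    using inj_on_eq_iff[OF admissible_inj_on[OF assms], of k l] k that by auto
  then have "(\<Sum>l\<in>{2..n}. if j k = j l then m l else 0) = (\<Sum>l\<in>{2..n}. if k = l then m l else 0)"
    by (intro sum.cong) auto
  then show "count (snd (block_key n j m)) (j k) = m k"
    unfolding count using k ne[OF k] by (simp add: sum.delta')
qed

text \<open>An equality in the free algebra itself, not only modulo identities:
  \<open>canonical_word\<close> of the key is literally the block word.\<close>

lemma block_monomial_eq_canonical:
  assumes adm: "admissible n j m"
  shows "block_monomial n j m = canonical_monomial (block_key n j m)"
proof -
  let ?w = "concat (map (\<lambda>k. replicate (m k) (j k)) [2..<n + 1])"
  have n: "1 \<le> n" "1 \<le> m 1" and mono: "strict_mono_on {2..n} j"
    using adm by (auto simp: admissible_def)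
  have ne: "j k \<noteq> j 1" if "k \<in> {2..n}" for k
    using adm that unfolding admissible_def by metis
  have "mono_on {2..<n + 1} j"
    using strict_mono_on_imp_mono_on[OF mono] by (simp add: mono_on_def)
  then have "sorted ?w" by (rule sorted_concat_replicate)
  then have w: "sorted_list_of_multiset (mset ?w) = ?w"
    by (simp add: sorted_sort_id)
  have "mset ?w = (\<Sum>k\<in>{2..n}. replicate_mset (m k) (j k))"
    unfolding mset_concat_replicate by (intro sum.cong) auto
  moreover have "filter_mset (\<lambda>x. x \<noteq> j 1) (mset ?w) = mset ?w"
    using ne by (fastforce simp: filter_mset_eq_conv)
  ultimately have "filter_mset (\<lambda>x. x \<noteq> j 1) (snd (block_key n j m)) = mset ?w"
    by (simp add: block_key_def)
  then have "canonical_word (block_key n j m) = j 1 # replicate (m 1 - 1) (j 1) @ ?w"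
    using w block_key_count(1)[OF adm] by (simp add: canonical_word_def block_key_def)
  also have "\<dots> = replicate (m 1) (j 1) @ ?w"
    using n by (cases "m 1") auto
  also have "\<dots> = concat (map (\<lambda>k. replicate (m k) (j k)) (1 # [2..<n + 1]))"
    by simp
  also have "1 # [2..<n + 1] = [1..<n + 1]"
    using n upt_conv_Cons[of 1 "n + 1"] by (simp del: upt_Suc add: numeral_2_eq_2)
  finally show ?thesis
    by (simp add: block_monomial_def canonical_monomial_def fl_word_def map_concat comp_def
        del: upt_Suc)
qed

text \<open>The first block takes \<open>i\<close> and all its copies in \<open>M\<close>; the other
  letters of \<open>M\<close>, in increasing order, give the later blocks.\<close>

lemma block_key_surj: "\<exists>n j m. admissible n j m \<and> block_key n j m = (i, M)"
proof -
  define S where "S = sorted_list_of_set (set_mset M - {i})"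
  define n where "n = Suc (length S)"
  \<comment> \<open>Block 2 is the first one taken from \<open>S\<close>, whose indices start at 0;
    hence the shift by 2.\<close>
  define j where "j k = (if k \<le> 1 then i else S ! (k - 2))" for k
  define m where "m k = (if k \<le> 1 then Suc (count M i) else count M (j k))" for k
  have j1: "j 1 = i" and m1: "m 1 = Suc (count M i)"
    by (simp_all add: j_def m_def)
  have S: "set S = set_mset M - {i}" "distinct S" "sorted_wrt (<) S"
    by (auto simp: S_def)
  have j_mem: "j k \<in> set_mset M - {i}" if "k \<in> {2..n}" for k
    using that nth_mem[of "k - 2" S] unfolding S(1)[symmetric] by (auto simp: j_def n_def)
  have mono: "strict_mono_on {2..n} j"
    using S(3) by (intro strict_mono_onI) (auto simp: j_def n_def sorted_wrt_iff_nth_less)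
  have "1 \<le> m k" if "k \<in> {1..n}" for k
  proof (cases "k = 1")
    case False
    then have "j k \<in># M" using j_mem[of k] that by auto
    then show ?thesis using False that by (simp add: m_def Suc_le_eq)
  qed (simp add: m_def)
  moreover have "j 1 \<noteq> j k" if "k \<in> {2..n}" for k
    using j_mem[OF that] j1 by force
  ultimately have "admissible n j m"
    using mono by (simp add: admissible_def n_def)
  moreover have "block_key n j m = (i, M)"
  proof -
    have "j ` {2..n} = set_mset M - {i}"
    proof (intro equalityI subsetI)
      fix x assume "x \<in> set_mset M - {i}"
      then obtain k where "k < length S" "x = S ! k"
        unfolding S(1)[symmetric] by (auto simp: in_set_conv_nth)
      then show "x \<in> j ` {2..n}"
        by (intro image_eqI[of _ _ "k + 2"]) (auto simp: j_def n_def)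
    qed (use j_mem in blast)
    moreover have "inj_on j {2..n}"
      using mono by (rule strict_mono_on_imp_inj_on)
    ultimately have "(\<Sum>k\<in>{2..n}. replicate_mset (count M (j k)) (j k)) =
        (\<Sum>x\<in>set_mset M - {i}. replicate_mset (count M x) x)"
      using sum.reindex[of j "{2..n}" "\<lambda>x. replicate_mset (count M x) x"] by simp
    then have "(\<Sum>k\<in>{2..n}. replicate_mset (m k) (j k)) =
        (\<Sum>x\<in>set_mset M - {i}. replicate_mset (count M x) x)"
      by (simp add: m_def)
    moreover have "replicate_mset (count M i) i +
        (\<Sum>x\<in>set_mset M - {i}. replicate_mset (count M x) x) = M"
      by (rule multiset_eqI) (auto simp: count_sum not_in_iff sum.delta)
    ultimately show ?thesis
      unfolding block_key_def j1 m1 by simp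
  qed
  ultimately show ?thesis by blast
qed

lemma B_L13_eq: "B_L13 = (range canonical_monomial :: 'k::field free_leibniz set)"
proof (intro equalityI subsetI)
  fix f :: "'k free_leibniz" assume "f \<in> B_L13"
  then show "f \<in> range canonical_monomial"
    by (auto simp: B_L13_def block_monomial_eq_canonical)
next
  fix f :: "'k free_leibniz" assume "f \<in> range canonical_monomial"
  then obtain i M where f: "f = canonical_monomial (i, M)" by auto
  obtain n j m where "admissible n j m" "block_key n j m = (i, M)"
    using block_key_surj by blast
  then have "f = block_monomial n j m" "admissible n j m"
    using f block_monomial_eq_canonical by metis+
  then show "f \<in> B_L13"
    unfolding B_L13_def by blast
qed

section \<open>Restricted monomials over a finite field\<close>

text \<open>The restrictions of the finite case in terms of keys. A pure power
  \<open>replicate_mset q j\<close> is kept although its monomial function is that of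
  \<open>{#j#}\<close>, because the two words differ in the second component of their values. Of the
  words on two letters only those in weakly increasing order are kept.\<close>

definition finite_keys :: "nat \<Rightarrow> (nat \<times> nat multiset) set"
  where "finite_keys q = {(i, M). M = {#} \<or> (\<exists>j\<ge>i. M = {#j#}) \<or>
    2 \<le> size M \<and> ((\<forall>j. count M j < q) \<or> (\<exists>j. M = replicate_mset q j))}"

lemma replicate_mset_eq_single_iff: "replicate_mset a x = {#y#} \<longleftrightarrow> a = 1 \<and> x = y"
  using replicate_mset_eq_iff[of a x "Suc 0" y] by simp

text \<open>The number of blocks decides the shape of the tail: a power of the leading letter, a
  product of two powers, or a multiset with at least two different letters.\<close>

lemma block_key_in_finite_keys:
  assumes adm: "admissible n j m" and q: "2 \<le> q"
  shows "block_key n j m \<in> finite_keys q \<longleftrightarrow>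
    (n \<ge> 2 \<and> m 1 > 1 \<longrightarrow> m 2 < q) \<and>
    (n = 1 \<longrightarrow> 1 \<le> m 1 \<and> m 1 \<le> q + 1) \<and>
    (n = 2 \<longrightarrow> (\<forall>i\<in>{1, 2}. 1 \<le> m i \<and> m i \<le> q) \<and> (m 1 = 1 \<and> m 2 = 1 \<longrightarrow> j 1 < j 2)) \<and>
    (n \<ge> 3 \<longrightarrow> 1 \<le> m 1 \<and> m 1 \<le> q \<and> (\<forall>i\<in>{2..n}. 1 \<le> m i \<and> m i < q))"
    (is "?key \<longleftrightarrow> ?cond")
proof -
  define M where "M = snd (block_key n j m)"
  have key: "block_key n j m = (j 1, M)" by (simp add: M_def block_key_def)
  have n1: "1 \<le> n" and m: "\<And>k. k \<in> {1..n} \<Longrightarrow> 1 \<le> m k"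
    using adm by (auto simp: admissible_def)
  have m1: "1 \<le> m 1" using n1 m by auto
  consider "n = 1" | "n = 2" | "3 \<le> n" using n1 by linarith
  then show ?thesis
  proof cases
    case 1
    then have M: "M = replicate_mset (m 1 - 1) (j 1)"
      by (simp add: M_def block_key_def)
    have "(\<forall>x. count M x < q) \<longleftrightarrow> m 1 - 1 < q"
      using q by (auto simp: M)
    \<comment> \<open>Besides the exponents below \<open>q\<close>, the value
      \<open>m 1 - 1 = q\<close> is allowed as a pure power; hence the bound \<open>q + 1\<close> on
      \<open>m 1\<close>.\<close>
    then have "?key \<longleftrightarrow> m 1 - 1 \<le> q"
      using q unfolding key finite_keys_def
      by (auto simp: M replicate_mset_eq_iff replicate_mset_eq_single_iff)
    then show ?thesis using 1 m1 by auto
  next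
    case 2
    have ne: "j 2 \<noteq> j 1" and m2: "1 \<le> m 2"
      using adm m 2 by (auto simp: admissible_def)
    have M: "M = replicate_mset (m 1 - 1) (j 1) + replicate_mset (m 2) (j 2)"
      by (simp add: M_def block_key_def 2)
    have small: "(\<forall>x. count M x < q) \<longleftrightarrow> m 1 - 1 < q \<and> m 2 < q"
    proof
      assume "\<forall>x. count M x < q"
      from this[rule_format, of "j 1"] this[rule_format, of "j 2"]
      show "m 1 - 1 < q \<and> m 2 < q" using ne by (simp add: M)
    qed (use ne in \<open>auto simp: M\<close>)
    \<comment> \<open>The second block is never empty, so the tail is a pure power only if the first
      block is the leading letter alone. This is where the restriction \<open>m 2 < q\<close> for
      \<open>m 1 > 1\<close> comes from.\<close>
    have rep: "M = replicate_mset a x \<longleftrightarrow> m 1 = 1 \<and> m 2 = a \<and> j 2 = x" for a x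
    proof
      assume eq: "M = replicate_mset a x"
      then have "j 2 = x"
        using m2 by (metis M count_eq_zero_iff count_union in_replicate_mset
            not_one_le_zero add_is_0 count_replicate_mset)
      moreover have "count M (j 1) = 0"
        using eq ne \<open>j 2 = x\<close> by auto
      ultimately show "m 1 = 1 \<and> m 2 = a \<and> j 2 = x"
        using m1 eq ne by (auto simp: M replicate_mset_eq_iff)
    qed (use m1 in \<open>auto simp: M\<close>)
    have key_iff: "?key \<longleftrightarrow> m 1 = 1 \<and> m 2 = 1 \<and> j 1 \<le> j 2 \<or>
        2 \<le> m 1 - 1 + m 2 \<and> (m 1 - 1 < q \<and> m 2 < q \<or> m 1 = 1 \<and> m 2 = q)"
      using rep[of 1] rep[of q] rep[of 0] small m2 m1 unfolding key finite_keys_def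
      by (auto simp: M)
    have le_iff: "j 1 \<le> j 2 \<longleftrightarrow> j 1 < j 2" using ne by linarith
    have cond_iff: "?cond \<longleftrightarrow> (m 1 > 1 \<longrightarrow> m 2 < q) \<and> m 1 \<le> q \<and> m 2 \<le> q \<and>
        (m 1 = 1 \<and> m 2 = 1 \<longrightarrow> j 1 < j 2)"
      using 2 m1 m2 by simp
    show ?thesis
    proof (cases "m 1 = 1")
      case True
      have "m 2 = 1 \<or> 2 \<le> m 2" using m2 by linarith
      then show ?thesis
        unfolding key_iff cond_iff le_iff using True q by fastforce
    next
      case False
      then have "m 1 - 1 < q \<longleftrightarrow> m 1 \<le> q" "2 \<le> m 1 - 1 + m 2" "1 < m 1"
        using m1 m2 by linarith+
      then show ?thesis
        unfolding key_iff cond_iff using False by auto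
    qed
  next
    case 3
    \<comment> \<open>Two different letters in the tail exclude the empty, the singleton and the
      pure power cases of \<open>finite_keys\<close>.\<close>
    have "count M (j 2) \<ge> 1" "count M (j 3) \<ge> 1"
      using block_key_count(2)[OF adm] m 3 by (auto simp: M_def)
    then have mem: "j 2 \<in># M" "j 3 \<in># M"
      by (auto simp: Suc_le_eq)
    have ne: "j 2 \<noteq> j 3"
      using inj_on_eq_iff[OF admissible_inj_on[OF adm], of 2 3] 3 by auto
    have norep: "M \<noteq> replicate_mset a x" for a x
      using mem ne by (auto split: if_splits)
    obtain N where N: "M = add_mset (j 2) N"
      using mem(1) by (blast dest: multi_member_split)
    then have "j 3 \<in># N" using mem(2) ne by auto
    then have size: "2 \<le> size M"
      by (cases N) (auto simp: N)
    have "(\<forall>x. count M x < q) \<longleftrightarrow> m 1 - 1 < q \<and> (\<forall>k\<in>{2..n}. m k < q)"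
    proof
      assume small: "\<forall>x. count M x < q"
      show "m 1 - 1 < q \<and> (\<forall>k\<in>{2..n}. m k < q)"
      proof (intro conjI ballI)
        show "m 1 - 1 < q"
          using small[rule_format, of "j 1"] block_key_count(1)[OF adm] by (simp add: M_def)
        show "m k < q" if "k \<in> {2..n}" for k
          using small[rule_format, of "j k"] block_key_count(2)[OF adm that] by (simp add: M_def)
      qed
    next
      assume *: "m 1 - 1 < q \<and> (\<forall>k\<in>{2..n}. m k < q)"
      show "\<forall>x. count M x < q"
      proof
        fix x
        have sub: "set_mset M \<subseteq> insert (j 1) (j ` {2..n})"
          by (auto simp: M_def block_key_def set_mset_sum split: if_splits)
        consider "x = j 1" | k where "k \<in> {2..n}" "x = j k" | "count M x = 0"
        proof (cases "x \<in># M")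
          case True
          then have "x = j 1 \<or> x \<in> j ` {2..n}" using sub by blast
          then show ?thesis using that(1,2) by blast
        qed (use that(3) in \<open>simp add: not_in_iff\<close>)
        then show "count M x < q"
        proof cases
          case 1
          then show ?thesis using * block_key_count(1)[OF adm] by (simp add: M_def)
        next
          case (2 k)
          then show ?thesis using * block_key_count(2)[OF adm] by (simp add: M_def)
        qed (use q in simp)
      qed
    qed
    then have "?key \<longleftrightarrow> m 1 - 1 < q \<and> (\<forall>k\<in>{2..n}. m k < q)"
      using size norep[of 0] norep[of 1] norep[of q] unfolding key finite_keys_def by auto
    moreover have "m 1 - 1 < q \<longleftrightarrow> m 1 \<le> q" "2 \<in> {2..n}" "n \<noteq> 1" "n \<noteq> 2"
      using 3 m1 by auto
    moreover have "\<forall>k\<in>{2..n}. 1 \<le> m k"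
      using m by simp
    ultimately show ?thesis using 3 m1 by blast
  qed
qed

lemma B_L13_finite_eq:
  assumes "2 \<le> q"
  shows "B_L13_finite q = (canonical_monomial ` finite_keys q :: 'k::field free_leibniz set)"
proof -
  have "B_L13_finite q = {block_monomial n j m :: 'k free_leibniz | n j m.
      admissible n j m \<and> block_key n j m \<in> finite_keys q}"
    unfolding B_L13_finite_def
    by (simp only: block_key_in_finite_keys[OF _ assms] cong: conj_cong)
  also have "\<dots> = canonical_monomial ` finite_keys q"
  proof (intro equalityI subsetI)
    fix f :: "'k free_leibniz" assume "f \<in> canonical_monomial ` finite_keys q"
    then obtain i M where f: "f = canonical_monomial (i, M)" "(i, M) \<in> finite_keys q" by auto
    obtain n j m where key: "admissible n j m" "block_key n j m = (i, M)"
      using block_key_surj by metis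
    then have "f = block_monomial n j m"
      using f block_monomial_eq_canonical by metis
    then show "f \<in> {block_monomial n j m | n j m.
        admissible n j m \<and> block_key n j m \<in> finite_keys q}"
      by (intro CollectI exI[of _ n] exI[of _ j] exI[of _ m]) (simp add: key f(2))
  qed (auto simp: block_monomial_eq_canonical)
  finally show ?thesis .
qed

section \<open>Spanning over a finite field\<close>

text \<open>Replacing x^q by x keeps the monomial function and lowers the size. A pure q-th power is
  not reduced, since that would leave a single letter.\<close>

lemma reduce_exponents:
  assumes fin: "finite (UNIV :: 'k::field set)" and "2 \<le> size M"
  shows "\<exists>N. 2 \<le> size N \<and> ((\<forall>j. count N j < CARD('k)) \<or> (\<exists>j. N = replicate_mset CARD('k) j)) \<and>
    (\<forall>c :: 'a \<Rightarrow> 'k. (\<Prod>j\<in>#M. c j) = (\<Prod>j\<in>#N. c j))"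
  using assms(2)
proof (induction "size M" arbitrary: M rule: less_induct)
  case less
  show ?case
  proof (cases "(\<forall>j. count M j < CARD('k)) \<or> (\<exists>j. M = replicate_mset CARD('k) j)")
    case True
    then show ?thesis using less(2) by blast
  next
    case False
    then obtain j where j: "CARD('k) \<le> count M j" "M \<noteq> replicate_mset CARD('k) j"
      by (auto simp: not_less)
    then obtain N where N: "M = N + replicate_mset CARD('k) j"
      by (metis count_le_replicate_mset_subset_eq subset_mset.diff_add)
    \<comment> \<open>A letter besides the q copies of \<open>j\<close> remains, so the reduced
      multiset still has size at least 2.\<close>
    have "N \<noteq> {#}" using N j(2) by auto
    then have "2 \<le> size (add_mset j N)" "size (add_mset j N) < size M"
      using finite_field_card_ge_2[OF fin] by (auto simp: N Suc_le_eq nonempty_has_size)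
    moreover have "(\<Prod>j\<in>#M. c j) = (\<Prod>j\<in>#add_mset j N. c j)" for c :: "'a \<Rightarrow> 'k"
      by (simp add: N finite_field_power_card[OF fin] mult.commute)
    ultimately show ?thesis using less(1) by metis
  qed
qed

lemma UNIV_spanned_finite:
  assumes fin: "finite (UNIV :: 'k::field set)"
  shows "(UNIV :: 'k free_leibniz set) \<subseteq>
    fl.span (canonical_monomial ` finite_keys CARD('k) \<union> T_L13)"
proof (rule UNIV_spanned)
  fix x :: "nat \<times> nat multiset"
  let ?q = "CARD('k)"
  let ?span = "fl.span (canonical_monomial ` finite_keys ?q \<union> (T_L13 :: 'k free_leibniz set))"
  have q: "2 \<le> ?q" by (rule finite_field_card_ge_2[OF fin])
  have key: "canonical_monomial y \<in> ?span" if "y \<in> finite_keys ?q" for y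
    using that by (intro fl.span_base) auto
  have cong: "f \<in> ?span" if "f - g \<in> T_L13" "g \<in> ?span" for f g
    using fl.span_add[OF fl.span_base[of "f - g"] that(2)] that(1) by simp
  obtain i M where x: "x = (i, M)" by (cases x)
  consider "M = {#}" | j where "M = {#j#}" "i \<le> j" | j where "M = {#j#}" "j < i" | "2 \<le> size M"
    by (metis One_nat_def Suc_1 Suc_leI le_neq_implies_less nonempty_has_size not_le_imp_less
        size_1_singleton_mset)
  then show "canonical_monomial x \<in> ?span"
  proof cases
    case (3 j)
    define power where "power i j = (canonical_monomial (i, replicate_mset ?q j) :: 'k free_leibniz)" for i j
    \<comment> \<open>Over a field with q elements, the differences of x_i x_j and
      \<open>power i j\<close> and of x_j x_i and \<open>power j i\<close> both take the value (0, -
      c_i c_j, 0), where c_i and c_j are the third coordinates substituted.\<close>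
    have "canonical_monomial x - (power i j + canonical_monomial (j, {#i#}) - power j i) \<in> T_L13"
      using q by (simp add: T_L13_iff x 3 power_def L13_eval_canonical Let_def
          finite_field_power_card[OF fin] vec_eq_iff forall_3 vector_3 algebra_simps)
    moreover have "power i j + canonical_monomial (j, {#i#}) - power j i \<in> ?span"
      unfolding power_def using q 3 by (intro fl.span_add fl.span_diff key) (auto simp: finite_keys_def)
    ultimately show ?thesis by (rule cong)
  next
    case 4
    obtain N where N: "2 \<le> size N" "(\<forall>j. count N j < ?q) \<or> (\<exists>j. N = replicate_mset ?q j)"
      "\<And>c :: nat \<Rightarrow> 'k. (\<Prod>j\<in>#M. c j) = (\<Prod>j\<in>#N. c j)"
      using reduce_exponents[OF fin 4] by metis
    show ?thesis
      unfolding x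
    proof (rule cong)
      show "canonical_monomial (i, M) - canonical_monomial (i, N) \<in> (T_L13 :: 'k free_leibniz set)"
        using N(3) by (intro canonical_cong[OF 4 N(1)])
      show "canonical_monomial (i, N) \<in> ?span"
        using N by (intro key) (auto simp: finite_keys_def)
    qed
  next
    case 1
    then show ?thesis unfolding x by (intro key) (simp add: finite_keys_def)
  next
    case 2
    then show ?thesis unfolding x by (intro key) (simp add: finite_keys_def)
  qed
qed

section \<open>Independence over a finite field\<close>

text \<open>The difference of the first two components detects exactly the words on two letters,
  which monomial functions cannot tell from pure q-th powers.\<close>

lemma L13_eval_canonical_12_diff:
  fixes c :: "nat \<Rightarrow> 'k::field"
  defines "\<rho> \<equiv> \<lambda>j. vector [0, 0, c j] :: 'k ^ 3"
  shows "L13_eval \<rho> (canonical_monomial (i, M)) $ 1 - L13_eval \<rho> (canonical_monomial (i, M)) $ 2 =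
    (if size M = 1 then c i * (\<Prod>j\<in>#M. c j) else 0)"
  by (auto simp: L13_eval_canonical \<rho>_def vector_3 Let_def)

text \<open>The difference of the components gives a relation between the functions c_i c_j.
  Indicator functions separate its coefficients, first the diagonal ones and then the
  others.\<close>

lemma relation_degree_two:
  fixes k :: "nat \<times> nat multiset \<Rightarrow> 'k::field"
  assumes F: "finite F" "F \<subseteq> finite_keys q"
    and T: "(\<Sum>x\<in>F. fl_scale (k x) (canonical_monomial x)) \<in> T_L13"
    and x: "(i, {#j#}) \<in> F"
  shows "k (i, {#j#}) = 0"
proof -
  have rel: "(\<Sum>x\<in>F. k x * (if size (snd x) = 1 then c (fst x) * (\<Prod>j\<in>#snd x. c j) else 0)) = 0"
    for c
  proof -
    define \<rho> where "\<rho> = (\<lambda>j. vector [0, 0, c j] :: 'k ^ 3)"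
    define S where "S r = (\<Sum>x\<in>F. k x * L13_eval \<rho> (canonical_monomial x) $ r)" for r
    have "S r = 0" for r
      using T[unfolded T_L13_iff, rule_format, of \<rho>]
      by (simp add: S_def L13_eval_sum vec_eq_iff)
    then have "0 = S 1 - S 2" by simp
    also have "\<dots> = (\<Sum>x\<in>F. k x * (if size (snd x) = 1 then c (fst x) * (\<Prod>j\<in>#snd x. c j) else 0))"
      unfolding S_def sum_subtractf[symmetric] right_diff_distrib[symmetric]
      by (intro sum.cong refl)
        (simp only: \<rho>_def L13_eval_canonical_12_diff split_paired_all fst_conv snd_conv)
    finally show ?thesis by simp
  qed
  have pick: "k (i, {#j#}) = 0"
    if "(i, {#j#}) \<in> F" and others: "\<And>a b. \<lbrakk>(a, {#b#}) \<in> F; a \<in> {i, j}; b \<in> {i, j}; (a, b) \<noteq> (i, j)\<rbrakk>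
      \<Longrightarrow> k (a, {#b#}) = 0" for i j
  proof -
    \<comment> \<open>Only words with both letters in this set survive the substitution, each with
      factor 1.\<close>
    define c where "c l = (if l \<in> {i, j} then 1 else 0 :: 'k)" for l
    define f where "f x = k x * (if size (snd x) = 1 then c (fst x) * (\<Prod>j\<in>#snd x. c j) else 0)" for x
    have "f x = 0" if "x \<in> F - {(i, {#j#})}" for x
    proof (cases "size (snd x) = 1")
      case True
      then obtain a b where "x = (a, {#b#})"
        by (metis prod.collapse size_1_singleton_mset)
      then show ?thesis using others[of a b] that by (auto simp: f_def c_def)
    qed (simp add: f_def)
    then have "sum f F = f (i, {#j#})"
      using F(1) \<open>(i, {#j#}) \<in> F\<close> by (simp add: sum.remove[of F "(i, {#j#})"] sum.neutral)
    then show ?thesis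
      using rel[of c] by (simp add: f_def c_def)
  qed
  have diag: "k (l, {#l#}) = 0" if "(l, {#l#}) \<in> F" for l
    using that by (rule pick) auto
  have ord: "a \<le> b" if "(a, {#b#}) \<in> F" for a b
    using subsetD[OF F(2) that] by (auto simp: finite_keys_def)
  show ?thesis
  proof (rule pick[OF x])
    fix a b assume ab: "(a, {#b#}) \<in> F" "a \<in> {i, j}" "b \<in> {i, j}" "(a, b) \<noteq> (i, j)"
    \<comment> \<open>The order in \<open>finite_keys\<close> excludes the reversed pair, so only
      diagonal pairs remain.\<close>
    then have "a = b" using ord[OF ab(1)] ord[OF x] by auto
    then show "k (a, {#b#}) = 0" using diag ab(1) by simp
  qed
qed

text \<open>Once the words on two letters have coefficient 0, each q-th power can take over the
  monomial function of the single letter without a clash, and all exponents are below q.\<close>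

lemma canonical_independent_finite:
  fixes k :: "nat \<times> nat multiset \<Rightarrow> 'k::field"
  assumes fin: "finite (UNIV :: 'k set)"
    and F: "finite F" "F \<subseteq> finite_keys CARD('k)"
    and T: "(\<Sum>x\<in>F. fl_scale (k x) (canonical_monomial x)) \<in> T_L13"
    and "x \<in> F"
  shows "k x = 0"
proof (cases "size (snd x) = 1")
  case True
  then obtain j where "snd x = {#j#}" by (metis size_1_singleton_mset)
  then show ?thesis
    using relation_degree_two[OF F T, of "fst x" j] \<open>x \<in> F\<close> by (metis prod.collapse)
next
  case False
  let ?q = "CARD('k)"
  have q: "2 \<le> ?q" by (rule finite_field_card_ge_2[OF fin])
  define F' where "F' = {x \<in> F. size (snd x) \<noteq> 1}"
  have "(\<Sum>x\<in>F'. fl_scale (k x) (canonical_monomial x)) =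
      (\<Sum>x\<in>F. fl_scale (k x) (canonical_monomial x))"
  proof (rule sum.mono_neutral_left[OF F(1)])
    show "\<forall>x\<in>F - F'. fl_scale (k x) (canonical_monomial x) = 0"
    proof
      fix x assume "x \<in> F - F'"
      moreover from this obtain i j where "x = (i, {#j#})"
        unfolding F'_def by (metis (mono_tags, lifting) DiffE mem_Collect_eq prod.collapse size_1_singleton_mset)
      ultimately have "k x = 0"
        using relation_degree_two[OF F T] by simp
      then show "fl_scale (k x) (canonical_monomial x) = 0" by simp
    qed
  qed (auto simp: F'_def)
  then have T': "(\<Sum>x\<in>F'. fl_scale (k x) (canonical_monomial x)) \<in> T_L13"
    using T by simp
  have fin': "finite F'" using F(1) by (simp add: F'_def)
  obtain i M where x: "x = (i, M)" by (cases x)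
  define G where "G = {M. (i, M) \<in> F'}"
  have fin_G: "finite G" unfolding G_def by (rule finite_pair_section[OF fin'])
  \<comment> \<open>On the multisets in \<open>G\<close> this only changes pure q-th powers, to
    their single letter; monomial functions are preserved because x^q = x.\<close>
  define red where "red M = (if \<forall>j. count M j < ?q then M else mset_set (set_mset M))" for M :: "nat multiset"
  have G: "M = {#} \<or> 2 \<le> size M \<and> (\<forall>j. count M j < ?q) \<or> (\<exists>j. M = replicate_mset ?q j)"
    if "M \<in> G" for M
    using that F(2) by (auto simp: G_def F'_def finite_keys_def)
  have red_rep: "red (replicate_mset ?q j) = {#j#}" for j
    using q by (auto simp: red_def)
  have red_small: "red M = M" if "\<forall>j. count M j < ?q" for M
    using that by (simp add: red_def)
  have red_cases: "red M = M \<and> (\<forall>j. count M j < ?q) \<and> size M \<noteq> 1 \<or>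
      (\<exists>j. M = replicate_mset ?q j \<and> red M = {#j#})" if "M \<in> G" for M
    using G[OF that] red_rep red_small q by fastforce
  \<comment> \<open>No multiset of size 1 is left in \<open>G\<close>, so a reduced q-th power
    cannot coincide with an unreduced multiset.\<close>
  have inj: "inj_on red G"
  proof (rule inj_onI)
    fix M N assume "M \<in> G" "N \<in> G" "red M = red N"
    then show "M = N"
      using red_cases[of M] red_cases[of N] by auto
  qed
  have "k (i, the_inv_into G red (red M)) = 0"
  proof (rule monomial_functions_independent[of "red ` G" "\<lambda>N. k (i, the_inv_into G red N)"])
    show "count N j < ?q" if "N \<in> red ` G" for N j
    proof -
      obtain M where "M \<in> G" "N = red M" using \<open>N \<in> red ` G\<close> by blast
      then show ?thesis using red_cases[of M] q by auto
    qed
    show "(\<Sum>N\<in>red ` G. k (i, the_inv_into G red N) * (\<Prod>j\<in>#N. c j)) = 0" for c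
    proof -
      have "(\<Prod>j\<in>#red M. c j) = (\<Prod>j\<in>#M. c j)" if "M \<in> G" for M
        using red_cases[OF that] finite_field_power_card[OF fin] by auto
      then have "(\<Sum>N\<in>red ` G. k (i, the_inv_into G red N) * (\<Prod>j\<in>#N. c j)) =
          (\<Sum>M\<in>G. k (i, M) * (\<Prod>j\<in>#M. c j))"
        by (simp add: sum.reindex[OF inj] the_inv_into_f_f[OF inj])
      also have "\<dots> = 0"
        unfolding G_def by (rule relation_leading_variable[OF fin' T'])
      finally show ?thesis .
    qed
    show "red M \<in> red ` G"
      using \<open>x \<in> F\<close> False by (simp add: G_def F'_def x)
  qed (use fin_G in simp)
  moreover have "M \<in> G" using \<open>x \<in> F\<close> False by (simp add: G_def F'_def x)
  ultimately show ?thesis by (simp add: x the_inv_into_f_f[OF inj])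
qed

lemma images_form_basis_finite:
  assumes "finite (UNIV :: 'k::field set)"
  shows "images_form_basis fl_scale UNIV (T_L13 :: 'k free_leibniz set)
    (canonical_monomial ` finite_keys CARD('k))"
  by (rule fl.images_form_basis_image[OF subspace_T_L13])
    (use UNIV_spanned_finite[OF assms] canonical_independent_finite[OF assms] in auto)

theorem corollary3p22:
  shows
    "(infinite (UNIV :: 'k::field set) \<longrightarrow>
        images_form_basis fl_scale UNIV (T_ideal (*s) (L13_mult :: 'k ^ 3 \<Rightarrow> 'k ^ 3 \<Rightarrow> 'k ^ 3))
          B_L13) \<and>
     (finite (UNIV :: 'k set) \<longrightarrow>
        images_form_basis fl_scale UNIV (T_ideal (*s) (L13_mult :: 'k ^ 3 \<Rightarrow> 'k ^ 3 \<Rightarrow> 'k ^ 3))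
          (B_L13_finite CARD('k))) \<and>
     (\<forall>n\<ge>1. codim (*s) (L13_mult :: 'k ^ 3 \<Rightarrow> 'k ^ 3 \<Rightarrow> 'k ^ 3) n = n) \<and>
     convergent (\<lambda>n. root n (real (codim (*s) (L13_mult :: 'k ^ 3 \<Rightarrow> 'k ^ 3 \<Rightarrow> 'k ^ 3) n))) \<and>
     exponent (*s) (L13_mult :: 'k ^ 3 \<Rightarrow> 'k ^ 3 \<Rightarrow> 'k ^ 3) = 1"
proof (intro conjI impI allI)
  assume fin: "finite (UNIV :: 'k set)"
  show "images_form_basis fl_scale UNIV (T_L13 :: 'k free_leibniz set) (B_L13_finite CARD('k))"
    unfolding B_L13_finite_eq[OF finite_field_card_ge_2[OF fin]]
    by (rule images_form_basis_finite[OF fin])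
next
  \<comment> \<open>The sequence is the n-th root of n. Convergence is a separate claim because
    \<open>lim\<close> denotes some value for divergent sequences as well.\<close>
  show "convergent (\<lambda>n. root n (real (codim (*s) (L13_mult :: 'k ^ 3 \<Rightarrow> 'k ^ 3 \<Rightarrow> 'k ^ 3) n)))"
    unfolding codim_L13 using LIMSEQ_root by (rule convergentI)
  show "exponent (*s) (L13_mult :: 'k ^ 3 \<Rightarrow> 'k ^ 3 \<Rightarrow> 'k ^ 3) = 1"
    unfolding exponent_def codim_L13 using LIMSEQ_root by (rule limI)
qed (simp_all add: images_form_basis_infinite codim_L13 B_L13_eq)

end
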